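(* Let $f$ be a polynomial of degree $d\geq 2$ with complex coefficients, and let $G$ be a Siegel disk of $f$. If the boundary $\partial G$ is arcwise connected, then $\partial G$ is a Jordan curve.
   Context: A polynomial $f$ is regarded as a rational map of the Riemann sphere $\overline{\mathbb{C}}$. A component $G$ of the Fatou set of $f$ is a Siegel disk if $f(G)=G$, $G$ contains a neutral fixed point $w_0$ (that is, $f(w_0)=w_0$ and $|f'(w_0)|=1$), and $f|_G$ is analytically conjugate to a rotation. It is known that then $f'(w_0)=e^{2\pi i\theta}$ with $\theta$ irrational. A Jordan curve is a space homeomorphic to the circle $S^1$. *)

theory Defs
  imports "HOL-Complex_Analysis.Complex_Analysis" "HOL-Computational_Algebra.Computational_Algebra"
begin

datatype riemann_sphere = Fin complex | Infty

text \<open>Stereographic projection onto the unit sphere of \<open>\<complex> \<times> \<real>\<close>, with the north pole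
  \<open>(0, 1)\<close> as the point at infinity.\<close>

fun stereo :: "riemann_sphere \<Rightarrow> complex \<times> real" where
  "stereo (Fin z) = (of_real (2 / ((cmod z)\<^sup>2 + 1)) * z, ((cmod z)\<^sup>2 - 1) / ((cmod z)\<^sup>2 + 1))"
| "stereo Infty = (0, 1)"

lemma norm_sq_plus_one_pos: "(cmod z)\<^sup>2 + 1 > 0"
  by (metis add_nonneg_pos zero_le_power2 zero_less_one)

lemma inj_stereo: "inj stereo"
proof -
  have lt: "((cmod z)\<^sup>2 - 1) / ((cmod z)\<^sup>2 + 1) \<noteq> 1" for z
    using norm_sq_plus_one_pos[of z] by (simp add: divide_eq_eq)
  have "z = w" if "stereo (Fin z) = stereo (Fin w)" for z w
  proof -
    let ?a = "(cmod z)\<^sup>2 + 1" and ?b = "(cmod w)\<^sup>2 + 1"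
    have pos: "?a > 0" "?b > 0" by (rule norm_sq_plus_one_pos)+
    have "1 - 2 / ?a = 1 - 2 / ?b"
      using that pos by (simp add: field_simps)
    then have ab: "?a = ?b" using pos by (simp add: field_simps)
    have "of_real (2 / ?a) * z = of_real (2 / ?b) * w" using that by simp
    then have "of_real (2 / ?a) * z = of_real (2 / ?a) * w" by (simp only: ab)
    moreover have "complex_of_real (2 / ?a) \<noteq> 0" using pos by (simp only: of_real_eq_0_iff) simp
    ultimately show ?thesis using mult_left_cancel by blast
  qed
  moreover have "stereo (Fin z) \<noteq> stereo Infty" "stereo Infty \<noteq> stereo (Fin z)" for z
    using lt[of z] by (auto dest: sym)
  ultimately show ?thesis
    by (intro injI) (metis riemann_sphere.exhaust)
qed

lemma dist_stereo_Fin_Infty: "dist (stereo (Fin z)) (stereo Infty) = 2 / sqrt (1 + (cmod z)\<^sup>2)"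
proof -
  let ?a = "(cmod z)\<^sup>2 + 1"
  have pos: "?a > 0" by (rule norm_sq_plus_one_pos)
  have "(2 / ?a * cmod z)\<^sup>2 + (((cmod z)\<^sup>2 - 1) / ?a - 1)\<^sup>2 = 4 / ?a"
  proof -
    have "((cmod z)\<^sup>2 - 1) / ?a - 1 = - 2 / ?a" using pos by (simp add: field_simps)
    then have "(2 / ?a * cmod z)\<^sup>2 + (((cmod z)\<^sup>2 - 1) / ?a - 1)\<^sup>2 = 4 * ?a / (?a * ?a)"
      by (simp add: power2_eq_square add_divide_distrib distrib_left)
    also have "\<dots> = 4 / ?a" using pos by (metis less_irrefl mult_divide_mult_cancel_right)
    finally show ?thesis .
  qed
  moreover have "norm (of_real (2 / ?a) * z) = 2 / ?a * cmod z"
    using pos by (simp only: norm_mult norm_of_real) simp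
  ultimately have "dist (stereo (Fin z)) (stereo Infty) = sqrt (4 / ?a)"
    by (simp only: stereo.simps dist_Pair_Pair dist_complex_def dist_real_def diff_0_right power2_abs)
  then show ?thesis by (simp add: real_sqrt_divide add.commute)
qed

text \<open>The chordal metric; all topological notions for \<^typ>\<open>riemann_sphere\<close> are derived from it.\<close>

instantiation riemann_sphere :: metric_space
begin

definition dist_riemann_sphere :: "riemann_sphere \<Rightarrow> riemann_sphere \<Rightarrow> real" where
  "dist p q = dist (stereo p) (stereo q)"

definition uniformity_riemann_sphere :: "(riemann_sphere \<times> riemann_sphere) filter" where
  "uniformity = (INF e\<in>{0<..}. principal {(p :: riemann_sphere, q). dist p q < e})"

definition open_riemann_sphere :: "riemann_sphere set \<Rightarrow> bool" where
  "open (U :: riemann_sphere set) \<longleftrightarrow> (\<forall>p\<in>U. \<forall>\<^sub>F (p', q) in uniformity. p' = p \<longrightarrow> q \<in> U)"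

instance
proof
  show "dist p q = 0 \<longleftrightarrow> p = q" for p q :: riemann_sphere
    by (simp add: dist_riemann_sphere_def inj_eq[OF inj_stereo])
  show "dist p q \<le> dist p r + dist q r" for p q r :: riemann_sphere
    by (simp add: dist_riemann_sphere_def dist_triangle2)
qed (simp_all add: uniformity_riemann_sphere_def open_riemann_sphere_def)

end

fun poly_sphere :: "complex poly \<Rightarrow> riemann_sphere \<Rightarrow> riemann_sphere" where
  "poly_sphere f (Fin z) = Fin (poly f z)"
| "poly_sphere f Infty = (if degree f = 0 then Fin (coeff f 0) else Infty)"

text \<open>Normality in the sense of Montel: the limit \<open>h\<close> is only required on \<open>U\<close>, and for families
  of continuous maps it is automatically continuous there.\<close>

definition normal_family_on ::
    "'a::topological_space set \<Rightarrow> ('a \<Rightarrow> 'b::metric_space) set \<Rightarrow> bool" where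
  "normal_family_on U \<F> \<longleftrightarrow>
     (\<forall>g :: nat \<Rightarrow> 'a \<Rightarrow> 'b. range g \<subseteq> \<F> \<longrightarrow>
        (\<exists>r h. strict_mono r \<and>
           (\<forall>K. compact K \<and> K \<subseteq> U \<longrightarrow> uniform_limit K (g \<circ> r) h sequentially)))"

definition fatou_set :: "complex poly \<Rightarrow> riemann_sphere set" where
  "fatou_set f =
     {p. \<exists>U. open U \<and> p \<in> U \<and> normal_family_on U (range (\<lambda>n. poly_sphere f ^^ n))}"

fun chart_at_infty :: "complex \<Rightarrow> riemann_sphere" where
  "chart_at_infty z = (if z = 0 then Infty else Fin (inverse z))"

text \<open>Holomorphy of a complex-valued function on an open subset of the sphere, tested in the
  two standard charts.\<close>

definition sphere_holomorphic_on ::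
    "(riemann_sphere \<Rightarrow> complex) \<Rightarrow> riemann_sphere set \<Rightarrow> bool" where
  "sphere_holomorphic_on \<phi> G \<longleftrightarrow>
     (\<phi> \<circ> Fin) holomorphic_on (Fin -` G) \<and>
     (\<phi> \<circ> chart_at_infty) holomorphic_on (chart_at_infty -` G)"

text \<open>An injective holomorphic map of \<open>G\<close> onto the unit disk has a holomorphic inverse,
  so the \<open>\<phi>\<close> below is a conformal isomorphism.\<close>

definition conjugate_to_rotation_on ::
    "(riemann_sphere \<Rightarrow> riemann_sphere) \<Rightarrow> riemann_sphere set \<Rightarrow> bool" where
  "conjugate_to_rotation_on F G \<longleftrightarrow>
     (\<exists>\<phi> c. cmod c = 1 \<and> sphere_holomorphic_on \<phi> G \<and> bij_betw \<phi> G (ball 0 1) \<and>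
        (\<forall>p\<in>G. \<phi> (F p) = c * \<phi> p))"

text \<open>Intended for polynomials of degree at least 2: infinity is then a superattracting
  fixed point, so a neutral fixed point is necessarily finite.\<close>

definition siegel_disk :: "complex poly \<Rightarrow> riemann_sphere set \<Rightarrow> bool" where
  "siegel_disk f G \<longleftrightarrow>
     G \<in> components (fatou_set f) \<and>
     poly_sphere f ` G = G \<and>
     (\<exists>w\<^sub>0. Fin w\<^sub>0 \<in> G \<and> poly f w\<^sub>0 = w\<^sub>0 \<and> cmod (deriv (poly f) w\<^sub>0) = 1) \<and>
     conjugate_to_rotation_on (poly_sphere f) G"

text \<open>Connectedness by injective paths, as opposed to the library's \<^const>\<open>path_connected\<close>.\<close>

definition arcwise_connected :: "'a::topological_space set \<Rightarrow> bool" where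
  "arcwise_connected S \<longleftrightarrow>
     (\<forall>x\<in>S. \<forall>y\<in>S. x \<noteq> y \<longrightarrow>
        (\<exists>g. arc g \<and> path_image g \<subseteq> S \<and> pathstart g = x \<and> pathfinish g = y))"

definition jordan_curve :: "'a::topological_space set \<Rightarrow> bool" where
  "jordan_curve S \<longleftrightarrow> S homeomorphic sphere (0::complex) 1"

end

theory Submission
  imports Defs
begin

text \<open>
  Write the Siegel disk as \<open>D\<close>, a bounded plane domain, with a conformal map \<open>\<phi>\<close> onto the unit disk
  that turns \<open>f\<close> into the rotation by \<open>c\<close>, and with inverse \<open>\<psi>\<close>. The number \<open>c\<close> is not a root of
  unity, since otherwise an iterate of \<open>f\<close> would be the identity. The proof avoids prime ends and
  rests on three observations.

  \<^bold>\<open>The boundary is shared with the outside.\<close> A point of \<open>\<partial>D\<close> lies in the Julia set, so by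
  Montel's theorem some iterate is large at points arbitrarily close to it. The iterates are bounded
  on the closure of \<open>D\<close>, hence by the maximum principle on the bounded components of its complement;
  so these points are in the unbounded one (\<open>outside_accumulates_at_julia_points\<close>). Consequently
  every Jordan curve in \<open>\<partial>D\<close> that encloses a point of \<open>D\<close> is all of \<open>\<partial>D\<close>
  (\<open>loop_is_common_frontier\<close>): otherwise a remaining boundary point would lie strictly inside or
  strictly outside, and there only one of the two domains can come near it.

  \<^bold>\<open>The boundary is locally connected.\<close> A common boundary of two domains can be arcwise connected
  without being a Jordan curve, as the Warsaw circle shows, so the dynamics has to enter. Let \<open>x\<close> be
  an accessible boundary point with \<open>f x \<noteq> x\<close>. An access path to \<open>x\<close>, seen in the disk, lands at
  a point \<open>\<zeta>\<close> of the circle (\<open>koebe_landing\<close>), and its image under \<open>f\<close> is an access path to \<open>f x\<close>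
  landing at \<open>c \<zeta> \<noteq> \<zeta>\<close>. The two join to a crosscut from \<open>x\<close> to \<open>f x\<close>. An arc \<open>A\<close> in \<open>\<partial>D\<close> from
  \<open>f x\<close> back to \<open>x\<close> completes it to a Jordan curve, and the side \<open>S\<close> of this curve that misses the
  outer domain cannot meet \<open>\<partial>D\<close>; so \<open>S \<subseteq> D\<close>, and the closure of \<open>S\<close> meets \<open>\<partial>D\<close> only in \<open>A\<close>
  (\<open>crosscut_side\<close>). In the disk, \<open>\<phi> ` S\<close> is a side of a crosscut with distinct end points, so it
  contains a one-sided neighbourhood of an arc of the circle
  (\<open>crosscut_complement_contains_sector\<close>). Finitely many rotates of it by powers of \<open>c\<close> contain all
  points near the circle, which means \<open>\<partial>D = \<Union>n<N. (f ^^ n) ` A\<close>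
  (\<open>frontier_finite_union_of_path_images\<close>). Thus \<open>\<partial>D\<close> is the image of a path.

  \<^bold>\<open>A path image that separates the plane contains a separating Jordan curve.\<close> Lift the path through
  \<open>exp\<close>, centred at a point of \<open>D\<close>. If the lift were a function of the point on \<open>\<partial>D\<close>, it would be a
  continuous logarithm there, which is impossible by Borsuk. A shortest piece of the path that closes
  up while its lift does not gives a simple closed curve of nonzero winding number
  (\<open>path_image_separating_contains_loop\<close>), and by the first observation this curve is \<open>\<partial>D\<close>.
\<close>

section \<open>Jordan curves inside separating path images\<close>

lemma continuous_on_compact_image:
  fixes r :: "'a::metric_space \<Rightarrow> 'b::metric_space" and \<Phi> :: "'b \<Rightarrow> 'c::metric_space"
  assumes "compact K" "continuous_on K r" "continuous_on K (\<Phi> \<circ> r)"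
  shows "continuous_on (r ` K) \<Phi>"
  unfolding continuous_on_closed_invariant
proof (intro allI impI)
  fix B :: "'c set" assume "closed B"
  then have "closedin (top_of_set K) (K \<inter> (\<Phi> \<circ> r) -` B)"
    using assms(3) by (simp add: continuous_closedin_preimage)
  then have "compact (K \<inter> (\<Phi> \<circ> r) -` B)"
    using closedin_compact assms(1) by blast
  then have "compact (r ` (K \<inter> (\<Phi> \<circ> r) -` B))"
    using assms(2) by (intro compact_continuous_image) (auto intro: continuous_on_subset)
  moreover have "r ` (K \<inter> (\<Phi> \<circ> r) -` B) \<inter> r ` K = \<Phi> -` B \<inter> r ` K" by auto
  ultimately show "\<exists>A. closed A \<and> A \<inter> r ` K = \<Phi> -` B \<inter> r ` K"
    using compact_imp_closed by blast
qed

text \<open>The easy half of Borsuk's criterion: a continuous logarithm of \<open>z - a\<close> would contract the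
  Borsuk map \<open>(z - a) / \<bar>z - a\<bar>\<close> on \<open>X\<close> to a constant.\<close>

lemma bounded_component_no_logarithm:
  assumes "compact X" "a \<notin> X" and bdd: "bounded (connected_component_set (- X) a)"
    and cont: "continuous_on X l" and l: "\<And>z. z \<in> X \<Longrightarrow> exp (l z) = z - (a::complex)"
  shows False
proof -
  have "\<exists>g. continuous_on X g \<and>
      (\<forall>z\<in>X. inverse (norm (z - a)) *\<^sub>R (z - a) = exp (\<i> * complex_of_real (g z)))"
  proof (intro exI conjI ballI)
    show "continuous_on X (\<lambda>z. Im (l z))"
      by (intro continuous_intros cont)
    fix z assume "z \<in> X"
    then have e: "z - a = exp (l z)" using l by simp
    show "inverse (norm (z - a)) *\<^sub>R (z - a) = exp (\<i> * complex_of_real (Im (l z)))"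
      unfolding e norm_exp_eq_Re cis_conv_exp[symmetric] by (subst exp_eq_polar) (simp add: scaleR_conv_of_real)
  qed
  then have "\<exists>c. homotopic_with_canon (\<lambda>x. True) X (sphere 0 1)
               (\<lambda>z. inverse (norm (z - a)) *\<^sub>R (z - a)) (\<lambda>x. c)"
    by (subst inessential_eq_continuous_logarithm_circle)
  then show False
    using Borsuk_map_essential_bounded_component[OF assms(1,2)] bdd by blast
qed

lemma log_path_exists:
  fixes a :: complex
  assumes "path \<gamma>" "a \<notin> path_image \<gamma>"
  obtains \<mu> where "path \<mu>" "\<And>t. t \<in> {0..1} \<Longrightarrow> exp (\<mu> t) = \<gamma> t - (a::complex)"
proof -
  have "continuous_on {0..1} (\<lambda>t. \<gamma> t - a)"
    using assms(1) unfolding path_def by (intro continuous_intros)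
  then obtain g where "continuous_on {0..1} g" "\<And>t. t \<in> {0..1} \<Longrightarrow> \<gamma> t - a = exp (g t)"
    using assms(2) continuous_logarithm_on_contractible[of "{0..1::real}" "\<lambda>t. \<gamma> t - a"]
    by (metis (no_types, lifting) convex_imp_contractible convex_real_interval(5) path_image_def image_eqI eq_iff_diff_eq_0)
  then show ?thesis using that by (auto simp: path_def)
qed

text \<open>If \<open>\<mu>\<close> depended only on the point \<open>\<gamma> t\<close>, it would descend to a logarithm on the path image; this
  descends continuously because a path is a quotient map onto its image.\<close>

lemma log_path_multivalued:
  fixes a :: complex
  assumes "path \<gamma>" "a \<notin> path_image \<gamma>"
    and bdd: "bounded (connected_component_set (- path_image \<gamma>) a)"
    and \<mu>: "path \<mu>" "\<And>t. t \<in> {0..1} \<Longrightarrow> exp (\<mu> t) = \<gamma> t - (a::complex)"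
  shows "\<exists>s\<in>{0..1}. \<exists>t\<in>{0..1}. \<gamma> s = \<gamma> t \<and> \<mu> s \<noteq> \<mu> t"
proof (rule ccontr)
  assume "\<not> ?thesis"
  then have eq: "\<mu> s = \<mu> t" if "s \<in> {0..1}" "t \<in> {0..1}" "\<gamma> s = \<gamma> t" for s t
    using that by blast
  define l where "l z = \<mu> (SOME t. t \<in> {0..1} \<and> \<gamma> t = z)" for z
  have l: "l (\<gamma> t) = \<mu> t" if "t \<in> {0..1}" for t
    unfolding l_def by (rule someI2[of _ t]) (use that in simp, rule eq, use that in simp_all)
  have "continuous_on {0..1} (l \<circ> \<gamma>)"
    using \<mu>(1) unfolding path_def by (rule continuous_on_eq) (simp add: l)
  then have cont: "continuous_on (path_image \<gamma>) l"
    using assms(1) unfolding path_image_def path_def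
    by (intro continuous_on_compact_image compact_Icc)
  show False
  proof (rule bounded_component_no_logarithm[OF _ assms(2) bdd cont])
    show "compact (path_image \<gamma>)" using assms(1) by (rule compact_path_image)
    show "exp (l z) = z - a" if "z \<in> path_image \<gamma>" for z
      using that l \<mu>(2) by (auto simp: path_image_def)
  qed
qed

text \<open>The gap \<open>2 * pi\<close> makes the inequality of two logarithms of the same number a closed
  condition.\<close>

lemma exp_eq_dist_ge:
  fixes x y :: complex
  assumes "exp x = exp y" "x \<noteq> y"
  shows "dist x y \<ge> 2 * pi"
proof -
  obtain n :: int where n: "x = y + (of_int (2 * n) * pi) * \<i>"
    using assms(1) exp_eq[of x y] by blast
  then have "n \<noteq> 0" using assms(2) by auto
  then have "\<bar>n\<bar> \<ge> 1" by simp
  then have "\<bar>real_of_int n\<bar> \<ge> 1" by linarith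
  moreover have "dist x y = 2 * pi * \<bar>real_of_int n\<bar>"
    using n by (simp add: dist_norm norm_mult)
  ultimately show ?thesis
    by (simp add: mult_le_cancel_left1)
qed

text \<open>Among the parameter pairs at which \<open>\<gamma>\<close> closes up but its logarithm does not, choose one that
  spans a shortest interval. On this interval the logarithm \<open>\<mu>\<close> takes congruent values only when they
  are equal or belong to the two ends. So an arc inside the image of this piece of \<open>\<mu>\<close>, joining its
  ends, is mapped by \<open>exp\<close> to a simple closed curve, whose winding number is the
  nonzero difference of the ends divided by \<open>2 * pi * \<i>\<close>.\<close>

lemma path_image_separating_contains_loop:
  fixes a :: complex
  assumes "path \<gamma>" "a \<notin> path_image \<gamma>"
    and bdd: "bounded (connected_component_set (- path_image \<gamma>) a)"
  obtains c where "simple_path c" "pathfinish c = pathstart c" "path_image c \<subseteq> path_image \<gamma>"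
     "a \<in> inside (path_image c)"
proof -
  obtain \<mu> where \<mu>: "path \<mu>" "\<And>t. t \<in> {0..1} \<Longrightarrow> exp (\<mu> t) = \<gamma> t - a"
    using log_path_exists assms(1,2) by blast
  have cont: "continuous_on {0..1} \<mu>" using \<mu>(1) by (simp add: path_def)
  have same: "\<gamma> s = \<gamma> t \<longleftrightarrow> exp (\<mu> s) = exp (\<mu> t)" if "s \<in> {0..1}" "t \<in> {0..1}" for s t
    using \<mu>(2) that by auto
  define Z where "Z = {p \<in> {0..1} \<times> {0..1}. exp (\<mu> (fst p)) = exp (\<mu> (snd p))
      \<and> 2 * pi \<le> dist (\<mu> (fst p)) (\<mu> (snd p))}"
  have npi: "\<not> pi \<le> 0" using pi_gt_zero by linarith
  have Z: "p \<in> Z \<longleftrightarrow> p \<in> {0..1} \<times> {0..1} \<and> exp (\<mu> (fst p)) = exp (\<mu> (snd p)) \<and> \<mu> (fst p) \<noteq> \<mu> (snd p)" for p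
    using exp_eq_dist_ge[of "\<mu> (fst p)" "\<mu> (snd p)"] npi
    unfolding Z_def by (cases "\<mu> (fst p) = \<mu> (snd p)") auto
  have c1: "continuous_on ({0..1} \<times> {0..1}) (\<lambda>p. \<mu> (fst p))"
    by (rule continuous_on_compose2[OF cont]) (auto intro: continuous_intros)
  have c2: "continuous_on ({0..1} \<times> {0..1}) (\<lambda>p. \<mu> (snd p))"
    by (rule continuous_on_compose2[OF cont]) (auto intro: continuous_intros)
  have "compact Z"
  proof -
    have cl: "closed ({0..1} \<times> {0..1} :: (real \<times> real) set)"
      by (intro closed_Times closed_atLeastAtMost)
    have "Z = {p \<in> {0..1} \<times> {0..1}. exp (\<mu> (fst p)) - exp (\<mu> (snd p)) = 0}
        \<inter> {p \<in> {0..1} \<times> {0..1}. 2 * pi \<le> dist (\<mu> (fst p)) (\<mu> (snd p))}"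
      unfolding Z_def by auto
    moreover have "closed \<dots>"
      by (intro closed_Int continuous_closed_preimage_constant continuous_on_closed_Collect_le
          cl continuous_intros c1 c2)
    ultimately have "closed Z" by simp
    moreover have "bounded Z"
      unfolding Z_def by (rule bounded_subset[of "{0..1} \<times> {0..1}"]) (auto intro: bounded_Times)
    ultimately show ?thesis by (simp add: compact_eq_bounded_closed)
  qed
  moreover have "Z \<noteq> {}"
    using log_path_multivalued[OF assms \<mu>] same Z by fastforce
  ultimately obtain p where p: "p \<in> Z" and pmin: "\<And>q. q \<in> Z \<Longrightarrow> \<bar>snd p - fst p\<bar> \<le> \<bar>snd q - fst q\<bar>"
  proof -
    assume "compact Z" "Z \<noteq> {}"
    moreover have "continuous_on Z (\<lambda>p. \<bar>snd p - fst p\<bar>)" by (intro continuous_intros)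
    ultimately show thesis
      using continuous_attains_inf[of Z "\<lambda>p. \<bar>snd p - fst p\<bar>"] that by blast
  qed
  define s t where "s = fst p" and "t = snd p"
  have st: "s \<in> {0..1}" "t \<in> {0..1}" "exp (\<mu> s) = exp (\<mu> t)" "\<mu> s \<noteq> \<mu> t"
    using p unfolding Z s_def t_def by auto
  define I where "I = closed_segment s t"
  have I: "I \<subseteq> {0..1}" using st unfolding I_def by (simp add: closed_segment_subset)
  have inj: "\<mu> u = \<mu> v \<or> {u, v} = {s, t}" if "u \<in> I" "v \<in> I" "exp (\<mu> u) = exp (\<mu> v)" for u v
  proof (rule disjCI)
    assume ne: "{u, v} \<noteq> {s, t}"
    show "\<mu> u = \<mu> v"
    proof (rule ccontr)
      assume "\<mu> u \<noteq> \<mu> v"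
      then have "(u, v) \<in> Z" using that I by (auto simp: Z)
      then have "\<bar>t - s\<bar> \<le> \<bar>v - u\<bar>" using pmin[of "(u, v)"] by (simp add: s_def t_def)
      then show False using ne that(1,2) \<open>\<mu> u \<noteq> \<mu> v\<close> unfolding I_def
        by (auto simp: closed_segment_eq_real_ivl split: if_splits)
    qed
  qed
  have sub: "path (subpath s t \<mu>)" using \<mu>(1) st path_subpath by blast
  then obtain \<eta> where \<eta>: "arc \<eta>" "path_image \<eta> \<subseteq> path_image (subpath s t \<mu>)"
      "pathstart \<eta> = \<mu> s" "pathfinish \<eta> = \<mu> t"
    using path_contains_arc[of "subpath s t \<mu>" "\<mu> s" "\<mu> t"] st(4) by (metis pathstart_subpath pathfinish_subpath)
  have \<eta>I: "\<exists>v\<in>I. \<eta> u = \<mu> v" if "u \<in> {0..1}" for u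
  proof -
    have "\<eta> u \<in> path_image (subpath s t \<mu>)" using \<eta>(2) that by (auto simp: path_image_def)
    then show ?thesis unfolding path_image_subpath_gen I_def by auto
  qed
  define c where "c = (\<lambda>z. a + z) \<circ> (exp \<circ> \<eta>)"
  have pexp: "path (exp \<circ> \<eta>)"
    using arc_imp_path[OF \<eta>(1)] by (intro path_continuous_image continuous_intros)
  have simp0: "simple_path (exp \<circ> \<eta>)"
    unfolding simple_path_def loop_free_def
  proof (intro conjI ballI impI pexp)
    fix x y :: real assume xy: "x \<in> {0..1}" "y \<in> {0..1}" and e: "(exp \<circ> \<eta>) x = (exp \<circ> \<eta>) y"
    obtain u v where uv: "u \<in> I" "v \<in> I" "\<eta> x = \<mu> u" "\<eta> y = \<mu> v" using \<eta>I xy by meson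
    have injeta: "inj_on \<eta> {0..1}" using \<eta>(1) by (simp add: arc_def)
    from inj[of u v] uv e have "\<mu> u = \<mu> v \<or> {u, v} = {s, t}" by auto
    then show "x = y \<or> x = 0 \<and> y = 1 \<or> x = 1 \<and> y = 0"
    proof
      assume "\<mu> u = \<mu> v"
      then have "\<eta> x = \<eta> y" using uv by simp
      then show ?thesis using inj_on_eq_iff[OF injeta] xy by blast
    next
      have e01: "\<eta> 0 = \<mu> s" "\<eta> 1 = \<mu> t" using \<eta>(3,4) by (auto simp: pathstart_def pathfinish_def)
      assume "{u, v} = {s, t}"
      then have "(\<eta> x = \<eta> 0 \<and> \<eta> y = \<eta> 1) \<or> (\<eta> x = \<eta> 1 \<and> \<eta> y = \<eta> 0)"
        using uv e01 by (auto simp: doubleton_eq_iff)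
      then show ?thesis using inj_on_eq_iff[OF injeta] xy by (metis atLeastAtMost_iff order_refl zero_le_one)
    qed
  qed
  show thesis
  proof
    show sc: "simple_path c" unfolding c_def simple_path_translation_eq by (rule simp0)
    show cc: "pathfinish c = pathstart c"
      using \<eta>(3,4) st(3) by (simp add: c_def pathfinish_def pathstart_def)
    show "path_image c \<subseteq> path_image \<gamma>"
    proof
      fix z assume "z \<in> path_image c"
      then obtain u where u: "u \<in> {0..1}" "z = a + exp (\<eta> u)" by (auto simp: path_image_def c_def)
      then obtain v where "v \<in> I" "\<eta> u = \<mu> v" using \<eta>I by blast
      then have "z = \<gamma> v" "v \<in> {0..1}" using u \<mu>(2)[of v] I by auto
      then show "z \<in> path_image \<gamma>" by (simp add: path_image_def)
    qed
    have "winding_number c a = winding_number (exp \<circ> \<eta>) 0"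
      by (subst winding_number_offset) (simp add: c_def o_def)
    also have "\<dots> \<noteq> 0"
      using winding_number_compose_exp[OF arc_imp_path[OF \<eta>(1)]] \<eta>(3,4) st(4) by simp
    finally have "a \<notin> outside (path_image c)"
      using winding_number_zero_in_outside[of c a] sc cc by (auto dest: simple_path_imp_path)
    moreover have "a \<notin> path_image c" by (auto simp: path_image_def c_def)
    ultimately show "a \<in> inside (path_image c)"
      using inside_Un_outside by fastforce
  qed
qed

text \<open>The curve separates \<open>G\<close> from the unbounded \<open>B\<close>, so a point of \<open>frontier G\<close> off the curve, being
  a limit of both, would lie on both sides of it.\<close>

lemma loop_is_common_frontier:
  fixes G B :: "complex set"
  assumes c: "simple_path c" "pathfinish c = pathstart c" "path_image c \<subseteq> frontier G"
    and a: "a \<in> G" "a \<in> inside (path_image c)"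
    and G: "open G" "connected G" and B: "connected B" "\<not> bounded B" "B \<inter> closure G = {}" "frontier G \<subseteq> closure B"
  shows "path_image c = frontier G"
proof
  note J = Jordan_inside_outside[OF c(1,2)]
  let ?J = "path_image c"
  have "frontier G \<subseteq> closure G" by (auto simp: frontier_def)
  then have disj: "G \<inter> ?J = {}" "B \<inter> ?J = {}"
    using c(3) G(1) B(3) by (auto simp: frontier_def interior_open)
  have "G \<inter> outside ?J = {}"
    using connectedD[OF G(2), of "inside ?J" "outside ?J"] J a disj(1) by blast
  then have clG: "closure G \<inter> outside ?J = {}" using J by (metis Int_commute open_Int_closure_eq_empty)
  have "B \<inter> inside ?J = {}"
  proof (rule ccontr)
    assume "B \<inter> inside ?J \<noteq> {}"
    then have "B \<inter> outside ?J = {}"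
      using connectedD[OF B(1), of "inside ?J" "outside ?J"] J disj(2) by blast
    then have "B \<subseteq> inside ?J" using J disj(2) by blast
    then show False using J B(2) bounded_subset by blast
  qed
  then have clB: "closure B \<inter> inside ?J = {}" using J by (metis Int_commute open_Int_closure_eq_empty)
  show "frontier G \<subseteq> ?J"
  proof
    fix x assume "x \<in> frontier G"
    then have "x \<in> closure G" "x \<in> closure B" using B(4) by (auto simp: frontier_def)
    then have "x \<notin> inside ?J \<union> outside ?J" using clG clB by blast
    then show "x \<in> ?J" using J by blast
  qed
qed (rule c(3))

section \<open>Landing of paths under bounded holomorphic maps\<close>

text \<open>The path \<open>exp \<circ> \<mu>\<close> crosses a sector of angle \<open>pi / m\<close>. Reflections in the sides of the sector
  generate a dihedral group of order \<open>2 * m\<close>, and the images of the path under it close up around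
  \<open>0\<close>. The product of \<open>g\<close> over the group, with conjugates at the reflections, is holomorphic, and on
  this closed curve each of its values has a factor bounded by \<open>\<epsilon>\<close>; the maximum principle carries the
  bound to \<open>0\<close>. The curve is handled through its image under \<open>z ^ m\<close>, which is only one path
  followed by its complex conjugate.\<close>

lemma dihedral_product_bound:
  fixes g :: "complex \<Rightarrow> complex" and \<mu> :: "real \<Rightarrow> complex" and k :: int
  assumes holo: "g holomorphic_on ball 0 1"
    and bdd: "\<And>z. z \<in> ball 0 1 \<Longrightarrow> norm (g z) \<le> M"
    and "m > 0" and \<mu>: "path \<mu>"
    and Im0: "Im (pathstart \<mu>) = k * pi / m" and Im1: "Im (pathfinish \<mu>) = (k + 1) * pi / m"
    and Re: "\<And>u. u \<in> {0..1} \<Longrightarrow> Re (\<mu> u) < 0"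
    and small: "\<And>u. u \<in> {0..1} \<Longrightarrow> norm (g (exp (\<mu> u))) \<le> \<epsilon>"
  shows "norm (g 0) ^ (2 * m) \<le> \<epsilon> * M ^ (2 * m - 1)"
proof -
  define \<nu> where "\<nu> = (\<lambda>u. of_nat m * \<mu> u)"
  \<comment> \<open>Conjugation reverses the imaginary part. Adding \<open>2 * (k + 1) * pi * \<i>\<close> reflects in the line of
    height \<open>(k + 1) * pi\<close> at which \<open>\<nu>\<close> ends, so that \<open>\<nu>'\<close> continues \<open>\<nu>\<close> up to height \<open>(k + 2) * pi\<close>.\<close>
  define \<nu>' where "\<nu>' = (\<lambda>u::real. 2 * (k + 1) * pi * \<i> + cnj (\<nu> (1 - u)))"
  define L where "L = \<nu> +++ \<nu>'"
  define \<Gamma> where "\<Gamma> = path_image (exp \<circ> L)"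
  define W where "W = inside \<Gamma>"
  define Z where "Z = {z. z ^ m \<in> W}"
  \<comment> \<open>A pair \<open>(w, b)\<close> encodes the rotation by \<open>w\<close>, composed with conjugation if \<open>b\<close> is false.\<close>
  define J where "J = {w::complex. w ^ m = 1} \<times> (UNIV :: bool set)"
  define h where "h i z = (if snd i then g (fst i * z) else cnj (g (cnj (fst i * z))))" for i :: "complex \<times> bool" and z
  define P where "P z = (\<Prod>i\<in>J. h i z)" for z
  have ends: "Im (\<nu> 0) = k * pi" "Im (\<nu> 1) = (k + 1) * pi"
    using Im0 Im1 \<open>m > 0\<close> unfolding \<nu>_def pathstart_def pathfinish_def by auto
  have p\<nu>: "path \<nu>"
    using \<mu> unfolding path_def \<nu>_def by (rule continuous_on_mult_left)
  have p\<nu>': "path \<nu>'"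
  proof -
    have "continuous_on {0..1} (\<lambda>u. \<nu> (1 - u))"
      using p\<nu> unfolding path_def
      by (rule continuous_on_compose2[of "{0..1}" \<nu>]) (auto intro!: continuous_intros)
    then show ?thesis
      unfolding path_def \<nu>'_def by (intro continuous_intros)
  qed
  have join: "pathfinish \<nu> = pathstart \<nu>'"
    unfolding pathfinish_def pathstart_def \<nu>'_def using ends(2)
    by (auto simp: complex_eq_iff algebra_simps)
  have pL: "path L" unfolding L_def using p\<nu> p\<nu>' join by simp
  have Ldiff: "pathfinish L - pathstart L = 2 * of_real pi * \<i>"
    unfolding L_def using ends(1)
    by (auto simp: complex_eq_iff pathfinish_def pathstart_def joinpaths_def \<nu>'_def algebra_simps)
  have wn: "winding_number (exp \<circ> L) 0 = 1"
    using winding_number_compose_exp[OF pL] Ldiff by simp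
  have e\<nu>: "exp (\<nu> u) = exp (\<mu> u) ^ m" for u
    by (simp add: \<nu>_def exp_of_nat_mult)
  have e\<nu>': "exp (\<nu>' u) = cnj (exp (\<mu> (1 - u))) ^ m" for u
  proof -
    have "exp (2 * of_int (k + 1) * of_real pi * \<i>) = 1"
      using exp_eq_1 by (auto simp: mult_ac intro: exI[of _ "k+1"])
    moreover have "exp (cnj (\<nu> (1 - u))) = cnj (exp (\<mu> (1 - u))) ^ m"
      by (simp add: exp_cnj[symmetric] e\<nu> del: exp_cnj)
    ultimately show ?thesis by (simp add: \<nu>'_def exp_add)
  qed
  have \<Gamma>: "\<exists>u\<in>{0..1}. y = exp (\<mu> u) ^ m \<or> y = cnj (exp (\<mu> u)) ^ m" if "y \<in> \<Gamma>" for y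
  proof -
    have "y \<in> exp ` (path_image \<nu> \<union> path_image \<nu>')"
      using that unfolding \<Gamma>_def path_image_compose L_def by (simp add: path_image_join[OF join])
    then obtain u where u: "u \<in> {0..1}" "y = exp (\<nu> u) \<or> y = exp (\<nu>' u)" by (auto simp: path_image_def)
    then show ?thesis
      using e\<nu>[of u] e\<nu>'[of u] by (metis atLeastAtMost_iff diff_ge_0_iff_ge diff_le_eq le_add_same_cancel1)
  qed
  have \<Gamma>ball: "\<Gamma> \<subseteq> ball 0 1"
  proof
    fix y assume "y \<in> \<Gamma>"
    then obtain u where u: "u \<in> {0..1}" "norm y = norm (exp (\<mu> u)) ^ m" using \<Gamma> by (force simp: norm_power)
    then have "norm (exp (\<mu> u)) < 1" using Re by simp
    then show "y \<in> ball 0 1" using u \<open>m > 0\<close> by (simp add: power_less_one_iff)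
  qed
  have pexp: "path (exp \<circ> L)" using pL by (intro path_continuous_image continuous_intros)
  have clo: "pathfinish (exp \<circ> L) = pathstart (exp \<circ> L)"
  proof -
    have "pathfinish L = pathstart L + 2 * of_real pi * \<i>" using Ldiff by (simp add: algebra_simps)
    then show ?thesis by (simp add: pathfinish_compose pathstart_compose exp_add)
  qed
  have closed\<Gamma>: "closed \<Gamma>" unfolding \<Gamma>_def using pexp by (rule closed_path_image)
  have W0: "0 \<in> W"
  proof -
    have "0 \<notin> \<Gamma>" unfolding \<Gamma>_def by (auto simp: path_image_def)
    moreover have "0 \<notin> outside \<Gamma>"
      using winding_number_zero_in_outside[OF pexp clo] wn unfolding \<Gamma>_def by auto
    ultimately show ?thesis unfolding W_def using inside_Un_outside by fastforce
  qed
  have oW: "open W" unfolding W_def using closed\<Gamma> by (rule open_inside)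
  have Wball: "W \<subseteq> ball 0 1"
  proof
    fix z assume "z \<in> W"
    then have "z \<notin> outside \<Gamma>" unfolding W_def using inside_Int_outside by blast
    then show "z \<in> ball 0 1"
      using convex_in_outside[of "ball (0::complex) 1" z] outside_mono[OF \<Gamma>ball] by (meson convex_ball subsetD)
  qed
  have clW: "closure W \<subseteq> W \<union> \<Gamma>"
    unfolding W_def using closure_inside_subset[OF closed\<Gamma>] by blast
  have inball: "z \<in> ball 0 1" if "z ^ m \<in> ball 0 1" for z :: complex
    using that \<open>m > 0\<close> by (simp add: norm_power power_less_one_iff)
  have oZ: "open Z"
    unfolding Z_def using oW open_vimage[of W "\<lambda>z. z ^ m"] by (simp add: vimage_def continuous_intros)
  have clZ: "closure Z \<subseteq> {z. z ^ m \<in> W \<union> \<Gamma>}"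
  proof -
    have "closed ((\<lambda>z. z ^ m) -` closure W)"
      by (intro closed_vimage closed_closure continuous_intros)
    moreover have "Z \<subseteq> (\<lambda>z. z ^ m) -` closure W" unfolding Z_def using closure_subset by blast
    ultimately have "closure Z \<subseteq> (\<lambda>z. z ^ m) -` closure W" by (rule closure_minimal[rotated])
    then show ?thesis using clW by auto
  qed
  have clZball: "closure Z \<subseteq> ball 0 1" using clZ inball Wball \<Gamma>ball by blast
  have unit: "norm w = 1" if "w ^ m = 1" for w :: complex
    using that \<open>m > 0\<close> by (metis norm_ge_zero norm_one norm_power power_eq_1_iff power_eq_imp_eq_base power_one)
  have finJ: "finite J" and cardJ: "card J = 2 * m"
    unfolding J_def using \<open>m > 0\<close> by (auto simp: card_cartesian_product card_roots_unity_eq finite_complex_roots_unity_explicit)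
  have holh: "h i holomorphic_on ball 0 1" if "i \<in> J" for i
  proof -
    have n1: "norm (fst i) = 1" using that unit by (auto simp: J_def)
    have g1: "(\<lambda>z. g (fst i * z)) holomorphic_on ball 0 1"
      using n1 holo by (intro holomorphic_on_compose_gen[unfolded o_def, of "\<lambda>z. fst i * z" _ g "ball 0 1"] holomorphic_intros)
        (auto simp: norm_mult)
    have g2: "(\<lambda>z. cnj (g (cnj (fst i * z)))) holomorphic_on ball 0 1"
    proof -
      have cnj_ball: "cnj ` ball 0 1 = ball 0 1"
      proof (intro set_eqI iffI)
        fix z :: complex assume "z \<in> ball 0 1"
        then show "z \<in> cnj ` ball 0 1" by (intro image_eqI[of _ _ "cnj z"]) auto
      qed auto
      have "(cnj \<circ> g \<circ> cnj) holomorphic_on ball 0 1"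
        by (rule holomorphic_on_compose_cnj_cnj) (simp_all add: holo cnj_ball)
      then have "(\<lambda>z. cnj (g (cnj z))) holomorphic_on ball 0 1" by (simp add: o_def)
      then show ?thesis
        using n1 by (intro holomorphic_on_compose_gen[unfolded o_def, of "\<lambda>z. fst i * z" _ "\<lambda>z. cnj (g (cnj z))" "ball 0 1"] holomorphic_intros)
          (auto simp: norm_mult)
    qed
    show ?thesis using g1 g2 by (cases "snd i") (simp_all add: h_def[abs_def])
  qed
  have holP: "P holomorphic_on ball 0 1" unfolding P_def using holh by (intro holomorphic_on_prod) auto
  have hM: "norm (h i z) \<le> M" if "i \<in> J" "z \<in> ball 0 1" for i z
  proof -
    have "norm (fst i) = 1" using that unit by (auto simp: J_def)
    then show ?thesis using bdd that(2) by (auto simp: h_def norm_mult)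
  qed
  have frP: "norm (P z) \<le> \<epsilon> * M ^ (2 * m - 1)" if "z \<in> frontier Z" for z
  proof -
    have zball: "z \<in> ball 0 1" using that clZball by (auto simp: frontier_def)
    have "z ^ m \<in> \<Gamma>" using that clZ oZ by (auto simp: frontier_def interior_open Z_def)
    then obtain u x where u: "u \<in> {0..1}" and x: "x = exp (\<mu> u) \<or> x = cnj (exp (\<mu> u))" "z ^ m = x ^ m"
      using \<Gamma> by blast
    have "x \<noteq> 0" using x(1) by auto
    then have "z \<noteq> 0" using x(2) \<open>m > 0\<close> by (metis power_not_zero zero_power)
    \<comment> \<open>the element of the dihedral group that moves \<open>z\<close> back to the original path\<close>
    define i where "i = (x / z, x = exp (\<mu> u))"
    have iJ: "i \<in> J" using x(2) \<open>z \<noteq> 0\<close> \<open>x \<noteq> 0\<close> by (simp add: i_def J_def power_divide)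
    have hi: "norm (h i z) \<le> \<epsilon>"
      using x(1) \<open>z \<noteq> 0\<close> small[OF u] by (auto simp: h_def i_def)
    have "norm (P z) = norm (h i z) * (\<Prod>j\<in>J - {i}. norm (h j z))"
      unfolding P_def prod_norm[symmetric] using finJ iJ by (simp add: prod.remove[of J i])
    also have "\<dots> \<le> \<epsilon> * (\<Prod>j\<in>J - {i}. M)"
      using hi hM[OF _ zball] by (intro mult_mono prod_mono) (auto intro: prod_nonneg order_trans[OF norm_ge_zero])
    also have "(\<Prod>j\<in>J - {i}. M) = M ^ (2 * m - 1)"
      using finJ iJ cardJ by simp
    finally show ?thesis .
  qed
  have "norm (P 0) \<le> \<epsilon> * M ^ (2 * m - 1)"
  proof (rule maximum_modulus_frontier[where S = Z and f = P and \<xi> = 0])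
    show "P holomorphic_on interior Z"
      using clZball closure_subset[of Z] interior_subset[of Z] by (intro holomorphic_on_subset[OF holP]) blast
    show "continuous_on (closure Z) P"
      using holP clZball holomorphic_on_imp_continuous_on continuous_on_subset by blast
    show "bounded Z" using bounded_subset[OF bounded_ball subset_trans[OF closure_subset clZball]] .
    show "0 \<in> Z" using W0 \<open>m > 0\<close> by (simp add: Z_def zero_power)
  qed (rule frP)
  moreover have "norm (P 0) = norm (g 0) ^ (2 * m)"
  proof -
    have "norm (P 0) = (\<Prod>i\<in>J. norm (g 0))"
      unfolding P_def prod_norm[symmetric] by (intro prod.cong) (auto simp: h_def)
    then show ?thesis using cardJ by simp
  qed
  ultimately show ?thesis by simp
qed

lemma cauchy_at_left_imp_convergent:
  fixes f :: "real \<Rightarrow> real"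
  assumes "\<And>e. e > 0 \<Longrightarrow> \<exists>T<1. \<forall>s\<in>{T<..<1}. \<forall>t\<in>{T<..<1}. \<bar>f s - f t\<bar> < e"
  shows "\<exists>l. (f \<longlongrightarrow> l) (at_left 1)"
proof -
  define x where "x n = 1 - 1 / real (Suc n)" for n
  have x1: "x n < 1" for n by (simp add: x_def)
  have xlim: "x \<longlonglongrightarrow> 1 - 0"
    unfolding x_def by (intro tendsto_intros LIMSEQ_Suc[OF lim_1_over_n])
  have ev: "eventually (\<lambda>n. x n > T) sequentially" if "T < 1" for T
    using order_tendstoD(1)[OF xlim] that by simp
  have "Cauchy (\<lambda>n. f (x n))"
  proof (rule metric_CauchyI)
    fix e :: real assume "e > 0"
    then obtain T where "T < 1" and T: "\<forall>s\<in>{T<..<1}. \<forall>t\<in>{T<..<1}. \<bar>f s - f t\<bar> < e" using assms by meson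
    obtain N where "\<And>n. n \<ge> N \<Longrightarrow> x n > T" using ev[OF \<open>T < 1\<close>] by (auto simp: eventually_sequentially)
    then show "\<exists>M. \<forall>m\<ge>M. \<forall>n\<ge>M. dist (f (x m)) (f (x n)) < e"
      using T x1 by (intro exI[of _ N]) (auto simp: dist_real_def)
  qed
  then obtain l where l: "(\<lambda>n. f (x n)) \<longlonglongrightarrow> l" using Cauchy_convergent convergent_def by blast
  have "(f \<longlongrightarrow> l) (at_left 1)"
  proof (rule tendstoI)
    fix e :: real assume "e > 0"
    then obtain T where "T < 1" and T: "\<forall>s\<in>{T<..<1}. \<forall>t\<in>{T<..<1}. \<bar>f s - f t\<bar> < e/2" using assms[of "e/2"] by auto
    have "eventually (\<lambda>n. dist (f (x n)) l < e/2) sequentially" using tendstoD[OF l, of "e/2"] \<open>e > 0\<close> by simp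
    then have "eventually (\<lambda>n. dist (f (x n)) l < e/2 \<and> x n > T) sequentially" using ev[OF \<open>T < 1\<close>] by eventually_elim auto
    then obtain n where n: "dist (f (x n)) l < e/2" "x n > T"
      using eventually_happens' sequentially_bot by blast
    have "dist (f t) l < e" if "t \<in> {T<..<1}" for t
    proof -
      have "\<bar>f t - f (x n)\<bar> < e/2" using T that n(2) x1 by auto
      then show ?thesis using n(1) unfolding dist_real_def by linarith
    qed
    then show "eventually (\<lambda>t. dist (f t) l < e) (at_left 1)"
      using \<open>T < 1\<close> by (intro eventually_at_leftI[of T]) auto
  qed
  then show ?thesis by blast
qed

text \<open>Koebe's lemma. If \<open>p\<close> did not land, its argument would oscillate by a fixed amount, or grow
  without bound, arbitrarily late. So for a suitable \<open>m\<close> the path would cross one of the \<open>2 * m\<close>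
  sectors of angle \<open>pi / m\<close> while \<open>g\<close> is as small along it as desired, and \<open>dihedral_product_bound\<close>
  would give \<open>g 0 = 0\<close>.\<close>

lemma koebe_landing:
  fixes g p :: "_ \<Rightarrow> complex"
  assumes holo: "g holomorphic_on ball 0 1"
    and bdd: "\<And>z. z \<in> ball 0 1 \<Longrightarrow> norm (g z) \<le> M"
    and g0: "g 0 \<noteq> 0"
    and p: "continuous_on {0..<1::real} p" "p ` {0..<1} \<subseteq> ball 0 1"
    and lim1: "((\<lambda>t. norm (p t)) \<longlongrightarrow> 1) (at_left 1)"
    and lim0: "((\<lambda>t. g (p t)) \<longlongrightarrow> 0) (at_left 1)"
  shows "\<exists>\<zeta>. norm \<zeta> = 1 \<and> (p \<longlongrightarrow> \<zeta>) (at_left 1)"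
proof -
  have "eventually (\<lambda>t. norm (p t) > 1/2) (at_left 1)"
    using order_tendstoD(1)[OF lim1, of "1/2"] by simp
  then obtain T0 where T0: "T0 < 1" "\<And>t. T0 < t \<Longrightarrow> t < 1 \<Longrightarrow> norm (p t) > 1/2"
    using eventually_at_left[of 0 "1::real"] by auto
  define T where "T = (max 0 T0 + 1) / 2"
  have T: "0 < T" "T < 1" "T0 < T" using T0(1) by (auto simp: T_def max_def)
  have sub: "{T..<1} \<subseteq> {0..<1}" using T by auto
  have "continuous_on {T..<1} p" using p(1) sub continuous_on_subset by blast
  moreover have "p t \<noteq> 0" if "t \<in> {T..<1}" for t
    using T0(2)[of t] that T by fastforce
  moreover have "contractible {T..<1}" by (intro convex_imp_contractible convex_real_interval)
  ultimately obtain \<mu> where \<mu>: "continuous_on {T..<1} \<mu>" and ep: "\<And>t. t \<in> {T..<1} \<Longrightarrow> p t = exp (\<mu> t)"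
    using continuous_logarithm_on_contractible by metis
  have norm_p: "norm (p t) = exp (Re (\<mu> t))" if "t \<in> {T..<1}" for t using ep[OF that] by simp
  have Re_neg: "Re (\<mu> t) < 0" if "t \<in> {T..<1}" for t
  proof -
    have "p t \<in> ball 0 1" using p(2) that sub by blast
    then show ?thesis using norm_p[OF that] by simp
  qed
  have "\<exists>S<1. \<forall>s\<in>{S<..<1}. \<forall>t\<in>{S<..<1}. \<bar>Im (\<mu> s) - Im (\<mu> t)\<bar> < e" if "e > 0" for e
  proof (rule ccontr)
    assume neg: "\<not> ?thesis"
    obtain m :: nat where m: "m > 0" "2 * pi / m < e"
    proof -
      obtain m :: nat where "2 * pi / e < m" using reals_Archimedean2 by blast
      moreover have "0 < 2 * pi / e" using \<open>e > 0\<close> by simp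
      then have "m > 0" using \<open>2 * pi / e < m\<close> by (metis less_trans of_nat_0_less_iff)
      ultimately show thesis using that[of m] \<open>e > 0\<close> by (auto simp: field_simps)
    qed
    have small: "norm (g 0) ^ (2 * m) \<le> \<epsilon> * M ^ (2 * m - 1)" if "\<epsilon> > 0" for \<epsilon>
    proof -
      have "eventually (\<lambda>t. norm (g (p t)) < \<epsilon>) (at_left 1)"
        using tendstoD[OF lim0 that] by simp
      then obtain S0 where S0: "S0 < 1" "\<And>t. S0 < t \<Longrightarrow> t < 1 \<Longrightarrow> norm (g (p t)) < \<epsilon>"
        using eventually_at_left[of 0 "1::real"] by auto
      have "max T S0 < 1" using T S0 by simp
      then obtain s t where st: "s \<in> {max T S0<..<1}" "t \<in> {max T S0<..<1}" "\<bar>Im (\<mu> s) - Im (\<mu> t)\<bar> \<ge> e"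
        using neg by (meson not_le)
      define a where "a = (if Im (\<mu> s) < Im (\<mu> t) then s else t)"
      define b where "b = (if Im (\<mu> s) < Im (\<mu> t) then t else s)"
      have ab: "a \<in> {max T S0<..<1}" "b \<in> {max T S0<..<1}" "Im (\<mu> b) - Im (\<mu> a) \<ge> e"
        using st by (auto simp: a_def b_def)
      define I where "I = closed_segment a b"
      have I: "I \<subseteq> {max T S0<..<1}" "a \<in> I" "b \<in> I"
        using ab unfolding I_def by (auto simp: closed_segment_subset)
      have IT: "I \<subseteq> {T..<1}" using I(1) by auto
      have "continuous_on I (\<lambda>t. Im (\<mu> t))" using \<mu> IT by (intro continuous_intros) (rule continuous_on_subset)
      then have conn: "connected ((\<lambda>t. Im (\<mu> t)) ` I)" by (intro connected_continuous_image) (simp_all add: I_def)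
      have hit: "\<exists>u\<in>I. Im (\<mu> u) = y" if "Im (\<mu> a) \<le> y" "y \<le> Im (\<mu> b)" for y
        using connectedD_interval[OF conn, of "Im (\<mu> a)" "Im (\<mu> b)" y] that I(2,3) by (metis (no_types, lifting) image_iff)
      \<comment> \<open>the first multiple of \<open>pi / m\<close> above the lower argument; as \<open>2 * pi / m < e\<close>, the
        next one is still below the upper argument\<close>
      define k where "k = \<lceil>Im (\<mu> a) * m / pi\<rceil>"
      have k: "Im (\<mu> a) * m / pi \<le> k" "k < Im (\<mu> a) * m / pi + 1" unfolding k_def by linarith+
      have k1: "Im (\<mu> a) \<le> k * pi / m" using k(1) m(1) pi_gt_zero by (simp add: field_simps)
      have "k * pi / m \<le> Im (\<mu> a) + pi / m" using k(2) m(1) pi_gt_zero by (simp add: field_simps)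
      moreover have "(k + 1) * pi / m = k * pi / m + pi / m" by (simp add: add_divide_distrib distrib_right)
      moreover have "2 * pi / m = pi / m + pi / m" by simp
      ultimately have k2: "(k + 1) * pi / m \<le> Im (\<mu> b)" using ab(3) m(2) by linarith
      have k3: "k * pi / m \<le> (k + 1) * pi / m" by (simp add: divide_right_mono)
      obtain u where u: "u \<in> I" "Im (\<mu> u) = k * pi / m" using hit[of "k * pi / m"] k1 k2 k3 by auto
      obtain v where v: "v \<in> I" "Im (\<mu> v) = (k + 1) * pi / m" using hit[of "(k + 1) * pi / m"] k1 k2 k3 by auto
      have uv: "closed_segment u v \<subseteq> I" using u v unfolding I_def by (simp add: closed_segment_subset)
      have inI: "linepath u v x \<in> I" if "x \<in> {0..1}" for x using that uv linepath_in_path by blast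
      have "norm (g 0) ^ (2 * m) \<le> \<epsilon> * M ^ (2 * m - 1)"
      proof (rule dihedral_product_bound[OF holo bdd m(1), of "\<mu> \<circ> linepath u v" k])
        show "path (\<mu> \<circ> linepath u v)"
          using uv IT \<mu> by (intro path_continuous_image) (auto intro: continuous_on_subset)
        show "Re ((\<mu> \<circ> linepath u v) x) < 0" if "x \<in> {0..1}" for x
          using inI[OF that] IT Re_neg by (auto simp del: atLeastLessThan_iff)
        show "norm (g (exp ((\<mu> \<circ> linepath u v) x))) \<le> \<epsilon>" if "x \<in> {0..1}" for x
        proof -
          have y: "linepath u v x \<in> I" by (rule inI[OF that])
          then have "exp (\<mu> (linepath u v x)) = p (linepath u v x)" using IT ep by (metis subsetD)
          moreover have "S0 < linepath u v x" "linepath u v x < 1" using y I(1) by auto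
          ultimately show ?thesis using S0(2)[of "linepath u v x"] by simp
        qed
      qed (use u v in \<open>simp_all add: pathstart_compose pathfinish_compose\<close>)
      then show ?thesis .
    qed
    have "norm (g 0) ^ (2 * m) \<le> 0"
    proof (rule tendsto_lowerbound)
      show "((\<lambda>\<epsilon>. \<epsilon> * M ^ (2 * m - 1)) \<longlongrightarrow> 0) (at_right 0)"
        by (rule tendsto_eq_intros refl | simp)+
      show "eventually (\<lambda>\<epsilon>. norm (g 0) ^ (2 * m) \<le> \<epsilon> * M ^ (2 * m - 1)) (at_right 0)"
        using small by (intro eventually_at_rightI[of 0 1]) auto
    qed simp
    moreover have "0 < norm (g 0) ^ (2 * m)" using g0 by (intro zero_less_power) simp
    ultimately show False by linarith
  qed
  then obtain l where l: "((\<lambda>t. Im (\<mu> t)) \<longlongrightarrow> l) (at_left 1)"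
    using cauchy_at_left_imp_convergent[of "\<lambda>t. Im (\<mu> t)"] by blast
  have evT: "eventually (\<lambda>t. t \<in> {T..<1}) (at_left 1)"
    using T by (intro eventually_at_leftI[of T]) auto
  have "((\<lambda>t. of_real (norm (p t)) * cis (Im (\<mu> t))) \<longlongrightarrow> of_real 1 * cis l) (at_left 1)"
    unfolding cis_conv_exp by (intro tendsto_intros lim1 l)
  then have "(p \<longlongrightarrow> of_real 1 * cis l) (at_left 1)"
  proof (rule Lim_transform_eventually)
    show "eventually (\<lambda>t. of_real (norm (p t)) * cis (Im (\<mu> t)) = p t) (at_left 1)"
      using evT by eventually_elim (metis norm_p ep exp_eq_polar)
  qed
  then show ?thesis by (intro exI[of _ "cis l"]) simp
qed

section \<open>Crosscuts, rotations and concatenated paths\<close>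

lemma continuous_on_Icc_extend:
  fixes h :: "real \<Rightarrow> 'a::topological_space"
  assumes "continuous_on {a..<b} h" "(h \<longlongrightarrow> l) (at_left b)" "a < b"
  shows "continuous_on {a..b} (\<lambda>t. if t = b then l else h t)" (is "continuous_on _ ?k")
  unfolding continuous_on
proof
  fix t assume t: "t \<in> {a..b}"
  show "(?k \<longlongrightarrow> ?k t) (at t within {a..b})"
  proof (cases "t = b")
    case True
    have "(?k \<longlongrightarrow> l) (at_left b)"
      by (rule Lim_transform_eventually[OF assms(2)]) (auto simp: eventually_at_filter)
    then show ?thesis using True assms(3) by (simp add: at_within_Icc_at_left)
  next
    case False
    then have tb: "t \<in> {a..<b}" using t by auto
    have eq: "at t within {a..b} = at t within {a..<b}"
      by (rule at_within_nhd[of _ "{..<b}"]) (use tb in auto)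
    have "(h \<longlongrightarrow> h t) (at t within {a..<b})"
      using assms(1) tb by (simp add: continuous_on)
    then have "(?k \<longlongrightarrow> h t) (at t within {a..<b})"
      by (rule Lim_transform_eventually) (auto simp: eventually_at_filter)
    then show ?thesis using eq False by simp
  qed
qed

text \<open>The crosscut \<open>\<gamma>\<close> of \<open>G\<close> and the boundary arc \<open>A\<close> form a Jordan curve disjoint from \<open>B\<close>. The side
  that misses \<open>B\<close> is open, so it misses the closure of \<open>B\<close> and with it the frontier of \<open>G\<close>; since it
  comes near the points of \<open>\<gamma>\<close> in \<open>G\<close>, it is contained in \<open>G\<close>. It is this side whose boundary
  behaviour is under control: there the frontier of \<open>G\<close> reduces to \<open>A\<close>.\<close>

lemma crosscut_side:
  fixes G B :: "complex set"
  assumes "open G" and B: "connected B" "B \<inter> closure G = {}" "frontier G \<subseteq> closure B"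
    and \<gamma>: "arc \<gamma>" "pathstart \<gamma> = x" "pathfinish \<gamma> = y" "path_image \<gamma> \<subseteq> G \<union> {x, y}"
    and A: "arc A" "pathstart A = y" "pathfinish A = x" "path_image A \<subseteq> frontier G"
  obtains S where "open S" "connected S" "S \<noteq> {}" "S \<subseteq> G"
    "frontier S = path_image \<gamma> \<union> path_image A"
proof -
  have GX: "G \<inter> frontier G = {}" using \<open>open G\<close> by (auto simp: frontier_def interior_open)
  have xy: "x \<in> path_image A" "y \<in> path_image A" using A pathstart_in_path_image pathfinish_in_path_image by metis+
  have "path_image \<gamma> \<inter> path_image A \<subseteq> {x, y}" using \<gamma>(4) A(4) GX by blast
  then have C: "simple_path (\<gamma> +++ A)"
    using \<gamma> A by (intro simple_path_join_loop) auto
  let ?C = "path_image (\<gamma> +++ A)"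
  have Ceq: "?C = path_image \<gamma> \<union> path_image A" using \<gamma> A by (simp add: path_image_join)
  have loop: "pathfinish (\<gamma> +++ A) = pathstart (\<gamma> +++ A)" using \<gamma> A by simp
  note J = Jordan_inside_outside[OF C loop]
  have "?C \<subseteq> G \<union> frontier G" using Ceq \<gamma>(4) A(4) xy by blast
  also have "\<dots> \<subseteq> closure G" using closure_subset[of G] by (auto simp: frontier_def)
  finally have "B \<inter> ?C = {}" using B(2) by blast
  then have "B \<subseteq> inside ?C \<union> outside ?C" using J by blast
  then have "inside ?C \<inter> B = {} \<or> outside ?C \<inter> B = {}"
    using J connectedD[OF B(1), of "inside ?C" "outside ?C"] by blast
  then obtain S where S: "S = inside ?C \<or> S = outside ?C" "S \<inter> B = {}" by blast
  have S': "open S" "connected S" "S \<noteq> {}" "frontier S = ?C" using S(1) J by auto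
  have "S \<inter> closure B = {}" using S(2) S'(1) by (simp add: open_Int_closure_eq_empty)
  then have SX: "S \<inter> frontier G = {}" using B(3) by blast
  have "path_image \<gamma> \<inter> G \<noteq> {}"
  proof
    assume "path_image \<gamma> \<inter> G = {}"
    then have "path_image \<gamma> \<subseteq> {x, y}" using \<gamma>(4) by blast
    then have "finite (path_image \<gamma>)" using finite_subset by blast
    then show False
      using \<gamma>(1) finite_imageD[of \<gamma> "{0..1}"] infinite_Icc[of 0 "1::real"]
      by (auto simp: arc_def path_image_def)
  qed
  then obtain v where v: "v \<in> G" "v \<in> frontier S" using S'(4) Ceq by blast
  then have "G \<inter> S \<noteq> {}" using \<open>open G\<close> by (auto simp: frontier_def closure_iff_nhds_not_empty)
  then have "S \<subseteq> G"
    using connected_Int_frontier[OF S'(2), of G] SX by blast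
  then show thesis using that[of S] S' Ceq by auto
qed

text \<open>Near a point of the circle off \<open>\<alpha>\<close>, the disk is either inside \<open>V\<close> or disjoint from \<open>V\<close>. If it
  were always disjoint, the frontier of \<open>V\<close> would be contained in the arc \<open>\<alpha>\<close>; but an arc does not
  separate the plane, so \<open>V\<close> would be unbounded.\<close>

lemma crosscut_complement_contains_sector:
  fixes V :: "complex set"
  assumes "open V" "V \<noteq> {}" "V \<subseteq> ball 0 1" "arc \<alpha>" and disj: "V \<inter> path_image \<alpha> = {}"
    and fr: "frontier V \<inter> ball 0 1 \<subseteq> path_image \<alpha>"
  obtains \<xi> \<epsilon> where "norm \<xi> = 1" "\<epsilon> > 0" "ball \<xi> \<epsilon> \<inter> ball 0 1 \<subseteq> V"
proof (rule ccontr)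
  note result = that
  assume neg: "\<not> thesis"
  have clo: "closed (path_image \<alpha>)" using assms(4) by (simp add: arc_imp_path closed_path_image)
  have "\<xi> \<in> path_image \<alpha>" if \<xi>: "\<xi> \<in> closure V" "norm \<xi> = 1" for \<xi>
  proof (rule ccontr)
    assume "\<xi> \<notin> path_image \<alpha>"
    then obtain \<epsilon> where \<epsilon>: "\<epsilon> > 0" "ball \<xi> \<epsilon> \<subseteq> - path_image \<alpha>"
      using clo by (metis ComplI open_Compl open_contains_ball)
    let ?D = "ball \<xi> \<epsilon> \<inter> ball 0 1"
    have "connected ?D" by (intro convex_connected convex_Int convex_ball)
    moreover have "?D \<inter> frontier V = {}" using fr \<epsilon> by blast
    moreover have "?D \<inter> V \<noteq> {}"
    proof -
      have "\<exists>y\<in>V. dist y \<xi> < \<epsilon>" using \<xi>(1) \<epsilon>(1) closure_approachable by blast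
      then obtain y where "y \<in> V" "y \<in> ball \<xi> \<epsilon>" by (auto simp: dist_commute)
      then show ?thesis using assms(3) by blast
    qed
    ultimately have "?D \<subseteq> V" using connected_Int_frontier[of ?D V] by blast
    then show False using neg result \<epsilon>(1) \<xi>(2) by blast
  qed
  moreover have "closure V \<subseteq> cball 0 1"
    using assms(3) by (intro closure_minimal) auto
  ultimately have "frontier V \<subseteq> path_image \<alpha>"
    using fr by (fastforce simp: frontier_def)
  then have "- path_image \<alpha> \<inter> frontier V = {}" by blast
  moreover have "connected (- path_image \<alpha>)" using assms(4) by (intro connected_arc_complement) auto
  moreover have "- path_image \<alpha> \<inter> V \<noteq> {}"
    using assms(2) disj by blast
  ultimately have "- path_image \<alpha> \<subseteq> V" using connected_Int_frontier[of "- path_image \<alpha>" V] by blast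
  then have "bounded (- path_image \<alpha>)" using assms(3) bounded_ball bounded_subset by blast
  moreover have "bounded (path_image \<alpha>)" using assms(4) by (simp add: bounded_arc_image)
  ultimately have "bounded (- path_image \<alpha> \<union> path_image \<alpha>)" by (simp only: bounded_Un)
  then show False by (simp add: Un_commute Compl_partition)
qed

text \<open>Kronecker's approximation theorem, transferred from fractional parts to the circle.\<close>

lemma rotation_orbit_dense:
  fixes c \<xi> \<eta> :: complex
  assumes c: "norm c = 1" "\<And>n. n > 0 \<Longrightarrow> c ^ n \<noteq> 1" and "norm \<xi> = 1" "norm \<eta> = 1" "\<epsilon> > 0"
  shows "\<exists>n. dist (c ^ n * \<xi>) \<eta> < \<epsilon>"
proof -
  define \<theta> where "\<theta> = Arg c / (2 * pi)"
  have c\<theta>: "c = cis (2 * pi * \<theta>)" using c(1) rcis_cmod_Arg[of c] by (simp add: \<theta>_def rcis_def)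
  define a where "a = Arg (\<eta> / \<xi>) / (2 * pi)"
  have "norm (\<eta> / \<xi>) = 1" using assms by (simp add: norm_divide)
  then have a: "\<eta> / \<xi> = cis (2 * pi * a)"
    using rcis_cmod_Arg[of "\<eta> / \<xi>"] by (simp add: a_def rcis_def)
  have "\<theta> \<notin> \<rat>"
  proof
    assume "\<theta> \<in> \<rat>"
    then obtain p q :: int where pq: "q > 0" "\<theta> = p / q"
      by (auto elim!: Rats_cases')
    have "c ^ nat q = cis (2 * pi * p)"
      using pq by (simp add: c\<theta> Complex.DeMoivre)
    also have "\<dots> = 1" using cis_multiple_2pi[of p] by simp
    finally show False using c(2)[of "nat q"] pq(1) by simp
  qed
  have "isCont cis 0" unfolding cis_conv_exp[abs_def] by (intro continuous_intros)
  then obtain \<delta> where \<delta>: "\<delta> > 0" "\<And>x. \<bar>x\<bar> < \<delta> \<Longrightarrow> dist (cis x) 1 < \<epsilon>"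
    using \<open>\<epsilon> > 0\<close> unfolding continuous_at_eps_delta by (auto simp: dist_norm)
  have "\<delta> / (2 * pi) > 0" using \<delta>(1) by simp
  then obtain h k :: int where k: "k > 0" "\<bar>of_int k * \<theta> - of_int h - a\<bar> < \<delta> / (2 * pi)"
    using sequence_of_fractional_parts_is_dense[OF \<open>\<theta> \<notin> \<rat>\<close>, of "\<delta> / (2 * pi)" a] by blast
  define x where "x = 2 * pi * (of_int k * \<theta> - of_int h - a)"
  have "\<bar>x\<bar> = 2 * pi * \<bar>of_int k * \<theta> - of_int h - a\<bar>" by (simp add: x_def abs_mult)
  also have "\<dots> < \<delta>" using k(2) by (simp add: field_simps)
  finally have x: "dist (cis x) 1 < \<epsilon>" by (rule \<delta>(2))
  have "cis (2 * pi * (of_int k * \<theta>)) = cis (x + 2 * pi * a + 2 * pi * of_int h)"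
    by (simp add: x_def algebra_simps)
  also have "\<dots> = cis x * cis (2 * pi * a)"
    using cis_multiple_2pi[of h] by (simp add: cis_mult[symmetric])
  finally have "c ^ nat k = cis x * (\<eta> / \<xi>)"
    using k(1) a by (simp add: c\<theta> Complex.DeMoivre mult_ac)
  then have "c ^ nat k * \<xi> = cis x * \<eta>" using assms(3) by (auto simp: field_simps)
  then have "dist (c ^ nat k * \<xi>) \<eta> = norm ((cis x - 1) * \<eta>)" by (simp add: dist_norm algebra_simps)
  also have "\<dots> = dist (cis x) 1" using assms(4) by (simp add: norm_mult dist_norm)
  finally show ?thesis using x by (intro exI[of _ "nat k"]) simp
qed

lemma finitely_many_rotations_cover_circle:
  fixes c \<xi> :: complex
  assumes c: "norm c = 1" "\<And>n. n > 0 \<Longrightarrow> c ^ n \<noteq> 1" and "norm \<xi> = 1" "\<epsilon> > 0"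
  shows "\<exists>N. \<forall>\<eta>. norm \<eta> = 1 \<longrightarrow> (\<exists>n<N. dist (c ^ n * \<xi>) \<eta> < \<epsilon>)"
proof -
  have "compact (sphere (0::complex) 1)" by simp
  moreover have "open (ball (c ^ n * \<xi>) \<epsilon>)" if "n \<in> UNIV" for n by simp
  moreover have "sphere 0 1 \<subseteq> (\<Union>n\<in>UNIV. ball (c ^ n * \<xi>) \<epsilon>)"
    using rotation_orbit_dense[OF c \<open>norm \<xi> = 1\<close> _ \<open>\<epsilon> > 0\<close>] by auto
  ultimately obtain F where F: "finite F" "sphere 0 1 \<subseteq> (\<Union>n\<in>F. ball (c ^ n * \<xi>) \<epsilon>)"
    by (rule compactE_image[where C = UNIV and f = "\<lambda>n. ball (c ^ n * \<xi>) \<epsilon>"]) auto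
  have "\<exists>n<Suc (Max F). dist (c ^ n * \<xi>) \<eta> < \<epsilon>" if "norm \<eta> = 1" for \<eta>
  proof -
    from that have "\<eta> \<in> sphere 0 1" by simp
    then obtain n where "n \<in> F" "dist (c ^ n * \<xi>) \<eta> < \<epsilon>" using F(2) by auto
    then show ?thesis using Max_ge[OF F(1)] by (metis le_imp_less_Suc)
  qed
  then show ?thesis by blast
qed

lemma finite_union_of_paths_in_path:
  fixes X :: "'a::real_normed_vector set"
  assumes "path_connected X" "X \<noteq> {}" "\<And>n. n < N \<Longrightarrow> path (a n) \<and> path_image (a n) \<subseteq> X"
  shows "\<exists>\<gamma>. path \<gamma> \<and> path_image \<gamma> \<subseteq> X \<and> (\<forall>n<(N::nat). path_image (a n) \<subseteq> path_image \<gamma>)"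
  using assms(3)
proof (induction N)
  case 0
  obtain x where "x \<in> X" using assms(2) by blast
  then show ?case by (intro exI[of _ "linepath x x"]) (simp add: path_def continuous_on_const)
next
  case (Suc N)
  then obtain \<gamma> where \<gamma>: "path \<gamma>" "path_image \<gamma> \<subseteq> X" "\<forall>n<N. path_image (a n) \<subseteq> path_image \<gamma>" by (meson less_SucI)
  have aN: "path (a N)" "path_image (a N) \<subseteq> X" using Suc.prems by auto
  have "pathfinish \<gamma> \<in> X" "pathstart (a N) \<in> X" using \<gamma> aN by auto
  then obtain e where e: "path e" "path_image e \<subseteq> X" "pathstart e = pathfinish \<gamma>" "pathfinish e = pathstart (a N)"
    using assms(1) unfolding path_connected_def by blast
  show ?case
    using \<gamma> aN e by (intro exI[of _ "\<gamma> +++ e +++ a N"]) (auto simp: path_image_join less_Suc_eq)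
qed

section \<open>The boundary of an irrational rotation domain\<close>

text \<open>The data extracted from a Siegel disk, now in the plane. The map \<open>f\<close> enters only through its
  continuity, its finitely many fixed points and its conjugacy with an irrational rotation on \<open>G\<close>.
  The set \<open>B\<close> stands for the unbounded component of the complement of the closure of \<open>G\<close>.\<close>

locale irrational_rotation_domain =
  fixes G :: "complex set" and f \<phi> \<psi> :: "complex \<Rightarrow> complex" and c :: complex and B :: "complex set"
  assumes openG: "open G" and connG: "connected G" and bddG: "bounded G"
    and contf: "continuous_on UNIV f"
    and cont\<phi>: "continuous_on G \<phi>" and \<phi>: "\<And>z. z \<in> G \<Longrightarrow> \<phi> z \<in> ball 0 1"
    and holo\<psi>: "\<psi> holomorphic_on ball 0 1" and \<psi>: "\<And>w. w \<in> ball 0 1 \<Longrightarrow> \<psi> w \<in> G"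
    and \<psi>\<phi>: "\<And>z. z \<in> G \<Longrightarrow> \<psi> (\<phi> z) = z" and \<phi>\<psi>: "\<And>w. w \<in> ball 0 1 \<Longrightarrow> \<phi> (\<psi> w) = w"
    and c1: "norm c = 1" and c_irr: "\<And>n. n > 0 \<Longrightarrow> c ^ n \<noteq> 1"
    and fG: "\<And>z. z \<in> G \<Longrightarrow> f z \<in> G" and f\<phi>: "\<And>z. z \<in> G \<Longrightarrow> \<phi> (f z) = c * \<phi> z"
    and B: "connected B" "\<not> bounded B" "B \<inter> closure G = {}" "frontier G \<subseteq> closure B"
    and pc: "path_connected (frontier G)"
    and fixfin: "finite {z. f z = z}"
begin

lemma G_Int_frontier: "G \<inter> frontier G = {}"
  using openG by (auto simp: frontier_def interior_open)

lemma closure_G: "closure G = G \<union> frontier G"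
  using openG closure_subset[of G] by (auto simp: frontier_def interior_open)

lemma G_nonempty: "\<psi> 0 \<in> G" by (rule \<psi>) simp

lemma cont\<psi>: "continuous_on (ball 0 1) \<psi>"
  using holo\<psi> by (rule holomorphic_on_imp_continuous_on)

text \<open>\<open>\<phi>\<close> is proper: the preimage of a smaller closed disk is compact, hence stays away from the
  frontier.\<close>

lemma \<phi>_tends_to_circle:
  assumes z: "\<And>n. z n \<in> G" "z \<longlonglongrightarrow> x" and "x \<in> frontier G"
  shows "(\<lambda>n. norm (\<phi> (z n))) \<longlonglongrightarrow> 1"
proof (rule tendstoI)
  fix e :: real assume "e > 0"
  have sub: "cball 0 (1 - e) \<subseteq> ball (0::complex) 1" using \<open>e > 0\<close> by auto
  then have "compact (\<psi> ` cball 0 (1 - e))"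
    by (intro compact_continuous_image continuous_on_subset[OF cont\<psi>]) auto
  then have "open (- \<psi> ` cball 0 (1 - e))" using compact_imp_closed by blast
  moreover have "x \<in> - \<psi> ` cball 0 (1 - e)" using \<psi> sub G_Int_frontier assms(3) by blast
  ultimately have "eventually (\<lambda>n. z n \<in> - \<psi> ` cball 0 (1 - e)) sequentially"
    using z(2) topological_tendstoD by blast
  then show "eventually (\<lambda>n. dist (norm (\<phi> (z n))) 1 < e) sequentially"
  proof eventually_elim
    case (elim n)
    have "\<phi> (z n) \<notin> cball 0 (1 - e)" using elim \<psi>\<phi>[OF z(1), of n] by force
    moreover have "norm (\<phi> (z n)) < 1" using \<phi>[OF z(1), of n] by simp
    ultimately show ?case by (simp add: dist_real_def)
  qed
qed

lemma frontier_seq: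
  assumes "x \<in> frontier G"
  obtains z where "\<And>n. z n \<in> G" "z \<longlonglongrightarrow> x"
  using assms closure_sequential[of x G] by (auto simp: frontier_def)

lemma frontierI:
  assumes "\<And>n. z n \<in> G" "z \<longlonglongrightarrow> x" "(\<lambda>n. norm (\<phi> (z n))) \<longlonglongrightarrow> 1"
  shows "x \<in> frontier G"
proof -
  have "x \<in> closure G" using assms(1,2) closure_sequential by blast
  moreover have "x \<notin> G"
  proof
    assume "x \<in> G"
    then have "(\<lambda>n. \<phi> (z n)) \<longlonglongrightarrow> \<phi> x"
      using assms(1,2) cont\<phi> by (auto simp: continuous_on_sequentially o_def)
    then have "norm (\<phi> x) = 1" using assms(3) LIMSEQ_unique tendsto_norm by blast
    then show False using \<phi>[OF \<open>x \<in> G\<close>] by simp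
  qed
  ultimately show ?thesis using closure_G by blast
qed

text \<open>A rotation preserves the distance to the circle, so \<open>f\<close> maps sequences tending to the frontier
  to such sequences.\<close>

lemma f_frontier:
  assumes "x \<in> frontier G" shows "f x \<in> frontier G"
proof -
  obtain z where z: "\<And>n. z n \<in> G" "z \<longlonglongrightarrow> x" using frontier_seq[OF assms] by blast
  have "(\<lambda>n. f (z n)) \<longlonglongrightarrow> f x" using contf z(2) by (simp add: continuous_on_sequentially o_def)
  moreover have "(\<lambda>n. norm (\<phi> (f (z n)))) \<longlonglongrightarrow> 1"
    using \<phi>_tends_to_circle[OF z assms] f\<phi>[OF z(1)] c1 by (simp add: norm_mult)
  ultimately show ?thesis using frontierI[of "\<lambda>n. f (z n)"] fG z(1) by blast
qed

lemma funpow_frontier: "x \<in> frontier G \<Longrightarrow> (f ^^ n) x \<in> frontier G"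
  by (induction n) (auto intro: f_frontier)

lemma funpow_G: "z \<in> G \<Longrightarrow> (f ^^ n) z \<in> G \<and> \<phi> ((f ^^ n) z) = c ^ n * \<phi> z"
  by (induction n) (auto simp: fG f\<phi>)

lemma cont_funpow: "continuous_on UNIV (f ^^ n)"
  by (induction n) (auto intro: continuous_on_compose2[OF contf])

text \<open>A finite set does not separate the plane.\<close>

lemma frontier_not_finite: "\<not> finite (frontier G)"
proof
  assume fin: "finite (frontier G)"
  then have "connected (- frontier G)"
    by (intro connected_open_delete_finite[of UNIV, simplified, folded Compl_eq_Diff_UNIV]) auto
  then have "- frontier G \<subseteq> G"
    using connected_Int_frontier[of "- frontier G" G] G_nonempty G_Int_frontier by blast
  then have "bounded (- frontier G)" using bddG bounded_subset by blast
  moreover have "bounded (frontier G)" using fin by (rule finite_imp_bounded)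
  ultimately have "bounded (- frontier G \<union> frontier G)" by (simp only: bounded_Un)
  then show False by (simp add: Un_commute Compl_partition)
qed

text \<open>A point of \<open>frontier G\<close> nearest to some \<open>g \<in> G\<close> is accessible along the segment from \<open>g\<close>. Such
  points are dense in the frontier, so one of them avoids the finite set of fixed points.\<close>

lemma accessible_nonfixed_point:
  obtains g x where "g \<in> G" "x \<in> frontier G" "f x \<noteq> x" "closed_segment g x - {x} \<subseteq> G"
proof -
  obtain x0 where x0: "x0 \<in> frontier G" "f x0 \<noteq> x0"
  proof -
    have "\<not> frontier G \<subseteq> {z. f z = z}" using frontier_not_finite fixfin finite_subset by blast
    then show thesis using that by blast
  qed
  have "open (- {z. f z = z})" using fixfin by (simp add: finite_imp_closed open_Compl)
  then obtain d where d: "d > 0" "ball x0 d \<subseteq> - {z. f z = z}"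
    using x0 open_contains_ball_eq[of "- {z. f z = z}" x0] by auto
  have "x0 \<in> closure G" using x0 by (simp add: frontier_def)
  then obtain g where g: "g \<in> G" "dist g x0 < d / 2"
    using closure_approachable[of x0 G] \<open>d > 0\<close> by (meson half_gt_zero)
  obtain x where x: "x \<in> frontier G" "\<And>y. y \<in> frontier G \<Longrightarrow> dist g x \<le> dist g y"
    using distance_attains_inf[of "frontier G" g] x0(1) by auto
  have "dist x x0 < d"
    using x(2)[OF x0(1)] g(2) dist_triangle3[of x x0 g] by (simp add: dist_commute)
  then have "f x \<noteq> x" using d(2) by (auto simp: dist_commute)
  have "ball g (dist g x) \<inter> frontier G = {}" using x(2) by fastforce
  moreover have "g \<in> ball g (dist g x)" using g(1) x(1) G_Int_frontier by auto
  ultimately have ballG: "ball g (dist g x) \<subseteq> G"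
    using connected_Int_frontier[of "ball g (dist g x)" G] g(1) by blast
  have "closed_segment g x - {x} \<subseteq> ball g (dist g x)"
  proof
    fix y assume "y \<in> closed_segment g x - {x}"
    then have "y = g \<or> y \<in> open_segment g x" by (auto simp: open_segment_def)
    then show "y \<in> ball g (dist g x)"
      using g(1) x(1) G_Int_frontier dist_in_open_segment[of y g x] by (auto simp: dist_commute)
  qed
  then show thesis using that[OF g(1) x(1) \<open>f x \<noteq> x\<close>] ballG by blast
qed

text \<open>\<open>koebe_landing\<close> applies to \<open>\<psi> w - r 1\<close>, which does not vanish at \<open>0\<close> because \<open>\<psi> 0\<close> lies in \<open>G\<close>
  and \<open>r 1\<close> does not.\<close>

lemma access_path_lands:
  assumes "path r" "r ` {0..<1} \<subseteq> G" "r 1 \<in> frontier G"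
  shows "\<exists>\<zeta>. norm \<zeta> = 1 \<and> ((\<lambda>t. \<phi> (r t)) \<longlongrightarrow> \<zeta>) (at_left 1)"
proof -
  obtain M where M: "\<And>z. z \<in> G \<Longrightarrow> norm z \<le> M" using bddG bounded_iff by metis
  show ?thesis
  proof (rule koebe_landing[of "\<lambda>w. \<psi> w - r 1"])
    have contr: "continuous_on {0..1} r" using assms(1) by (simp add: path_def)
    have "(r \<longlongrightarrow> r 1) (at 1 within {0..1})" using contr by (simp add: continuous_on)
    then have lim: "(r \<longlongrightarrow> r 1) (at_left 1)"
      by (simp add: at_within_Icc_at_left)
    have ev: "eventually (\<lambda>t. t \<in> {0..<1::real}) (at_left 1)"
      by (intro eventually_at_leftI[of 0]) auto
    show "(\<lambda>w. \<psi> w - r 1) holomorphic_on ball 0 1" by (intro holomorphic_intros holo\<psi>)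
    show "norm (\<psi> w - r 1) \<le> M + norm (r 1)" if "w \<in> ball 0 1" for w
      using norm_triangle_ineq4[of "\<psi> w" "r 1"] M[OF \<psi>[OF that]] by linarith
    show "\<psi> 0 - r 1 \<noteq> 0" using G_nonempty assms(3) G_Int_frontier by auto
    show "continuous_on {0..<1} (\<lambda>t. \<phi> (r t))"
      using assms(2) contr by (intro continuous_on_compose2[OF cont\<phi>]) (auto intro: continuous_on_subset)
    show "(\<lambda>t. \<phi> (r t)) ` {0..<1} \<subseteq> ball 0 1" using assms(2) \<phi> by blast
    show "((\<lambda>t. norm (\<phi> (r t))) \<longlongrightarrow> 1) (at_left 1)"
    proof (rule tendsto_at_left_sequentially[of 0])
      fix S :: "nat \<Rightarrow> real" assume S: "\<And>n. S n < 1" "\<And>n. 0 < S n" "incseq S" "S \<longlonglongrightarrow> 1"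
      show "(\<lambda>n. norm (\<phi> (r (S n)))) \<longlonglongrightarrow> 1"
      proof (rule \<phi>_tends_to_circle[OF _ _ assms(3)])
        show "r (S n) \<in> G" for n using assms(2) S(1,2)[of n] by (auto simp: image_subset_iff)
        show "(\<lambda>n. r (S n)) \<longlonglongrightarrow> r 1"
          using contr S(1,2,4) unfolding continuous_on_sequentially by (force simp: o_def less_imp_le)
      qed
    qed simp
    show "((\<lambda>t. \<psi> (\<phi> (r t)) - r 1) \<longlongrightarrow> 0) (at_left 1)"
    proof (rule Lim_transform_eventually)
      show "((\<lambda>t. r t - r 1) \<longlongrightarrow> 0) (at_left 1)" using lim by (simp add: LIM_zero)
      show "eventually (\<lambda>t. r t - r 1 = \<psi> (\<phi> (r t)) - r 1) (at_left 1)"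
        using ev
      proof eventually_elim
        case (elim t)
        then have "r t \<in> G" using assms(2) by blast
        then show ?case by (simp add: \<psi>\<phi>)
      qed
    qed
  qed
qed

text \<open>The crosscut \<open>\<gamma>\<close> runs back along an access segment from its end \<open>x\<close>, through \<open>G\<close>, and out along
  the image of the segment under \<open>f\<close>. In the disk, its ends correspond to \<open>\<zeta>\<close> and \<open>c * \<zeta>\<close>, which
  differ. Extending \<open>\<phi>\<close> by these two values is therefore continuous and injective on the crosscut
  and maps it to an arc \<open>\<alpha>\<close>.\<close>

lemma landing_crosscut:
  obtains \<gamma> \<alpha> where "arc \<gamma>" "pathstart \<gamma> \<in> frontier G" "pathfinish \<gamma> \<in> frontier G"
    "path_image \<gamma> \<subseteq> G \<union> {pathstart \<gamma>, pathfinish \<gamma>}" "arc \<alpha>"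
    "\<And>z. z \<in> path_image \<gamma> \<inter> G \<Longrightarrow> \<phi> z \<in> path_image \<alpha>"
    "\<And>w. w \<in> path_image \<alpha> \<inter> ball 0 1 \<Longrightarrow> \<psi> w \<in> path_image \<gamma>"
proof -
  obtain g x where g: "g \<in> G" and x: "x \<in> frontier G" "f x \<noteq> x" and seg: "closed_segment g x - {x} \<subseteq> G"
    using accessible_nonfixed_point by blast
  define r where "r = linepath g x"
  have r: "path r" "r 0 = g" "r 1 = x" "path_image r = closed_segment g x"
    by (simp_all add: r_def linepath_0' linepath_1')
  have gx: "g \<noteq> x" using g x(1) G_Int_frontier by blast
  have rG: "r t \<in> G" if "t \<in> {0..<1}" for t
  proof -
    have "r t \<in> closed_segment g x" using that unfolding r_def by (intro linepath_in_path) auto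
    moreover have "r t \<noteq> x"
    proof
      assume "r t = x"
      then have "(1 - t) *\<^sub>R (g - x) = 0" by (simp add: r_def linepath_def algebra_simps)
      then show False using gx that by simp
    qed
    ultimately show ?thesis using seg by blast
  qed
  obtain \<zeta> where \<zeta>: "norm \<zeta> = 1" "((\<lambda>t. \<phi> (r t)) \<longlongrightarrow> \<zeta>) (at_left 1)"
  proof -
    have "r ` {0..<1} \<subseteq> G" "r 1 \<in> frontier G" using rG x(1) r(3) by auto
    then show thesis using access_path_lands[OF r(1)] that by blast
  qed
  define y where "y = f x"
  have y: "y \<in> frontier G" "y \<noteq> x" unfolding y_def using f_frontier[OF x(1)] x(2) by auto
  define \<Phi> where "\<Phi> z = (if z = x then \<zeta> else if z = y then c * \<zeta> else \<phi> z)" for z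
  have \<Phi>G: "\<Phi> z = \<phi> z" if "z \<in> G" for z
    using that x(1) y(1) G_Int_frontier by (auto simp: \<Phi>_def)
  have \<Phi>xy: "\<Phi> x = \<zeta>" "\<Phi> y = c * \<zeta>" using y(2) by (auto simp: \<Phi>_def)
  have c\<zeta>: "c * \<zeta> \<noteq> \<zeta>" "norm (c * \<zeta>) = 1" using c_irr[of 1] \<zeta>(1) c1 by (auto simp: norm_mult)
  have "path_connected G" using openG connG by (simp add: connected_open_path_connected)
  then obtain e where e: "path e" "path_image e \<subseteq> G" "pathstart e = g" "pathfinish e = f g"
    using g fG[OF g] unfolding path_connected_def by blast
  have pfr: "path (f \<circ> r)" using r(1) contf by (intro path_continuous_image) (auto intro: continuous_on_subset)
  have ends: "pathstart r = g" "pathfinish r = x" "pathstart (f \<circ> r) = f g" "pathfinish (f \<circ> r) = f x"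
    using r by (simp_all add: pathstart_def pathfinish_def)
  define q where "q = reversepath r +++ e +++ (f \<circ> r)"
  have q: "path q" "pathstart q = x" "pathfinish q = y"
    using e pfr r ends by (simp_all add: q_def y_def)
  have qim: "path_image q = path_image r \<union> (path_image e \<union> path_image (f \<circ> r))"
    using e pfr r ends by (simp add: q_def path_image_join)
  obtain \<gamma> where \<gamma>: "arc \<gamma>" "path_image \<gamma> \<subseteq> path_image q" "pathstart \<gamma> = x" "pathfinish \<gamma> = y"
    using path_contains_arc[OF q] y(2) by metis
  have contr: "continuous_on {0..1} r" using r(1) by (simp add: path_def)
  have cpr: "continuous_on {0..<1} (\<lambda>t. \<phi> (r t))"
    using rG contr by (intro continuous_on_compose2[OF cont\<phi>]) (auto intro: continuous_on_subset)
  have "continuous_on {0..1} (\<lambda>t. if t = 1 then \<zeta> else \<phi> (r t))"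
    by (rule continuous_on_Icc_extend[OF cpr \<zeta>(2)]) simp
  then have "continuous_on {0..1} (\<Phi> \<circ> r)"
    by (rule continuous_on_eq) (auto simp: \<Phi>G rG \<Phi>xy r)
  then have cont1: "continuous_on (path_image r) \<Phi>"
    unfolding path_image_def by (intro continuous_on_compact_image contr compact_Icc)
  have "continuous_on {0..1} (\<lambda>t. if t = 1 then c * \<zeta> else c * \<phi> (r t))"
    by (rule continuous_on_Icc_extend) (auto intro!: tendsto_intros \<zeta>(2) continuous_on_mult_left cpr)
  then have "continuous_on {0..1} (\<Phi> \<circ> (f \<circ> r))"
  proof (rule continuous_on_eq)
    fix t :: real assume "t \<in> {0..1}"
    then show "(if t = 1 then c * \<zeta> else c * \<phi> (r t)) = (\<Phi> \<circ> (f \<circ> r)) t"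
      using \<Phi>xy(2) rG[of t] fG f\<phi> \<Phi>G[of "f (r t)"] by (auto simp: r y_def)
  qed
  then have cont2: "continuous_on (path_image (f \<circ> r)) \<Phi>"
    using pfr unfolding path_image_def path_def by (intro continuous_on_compact_image compact_Icc)
  have cont3: "continuous_on (path_image e) \<Phi>"
    using continuous_on_subset[OF cont\<phi> e(2)] by (rule continuous_on_eq) (use e(2) \<Phi>G in auto)
  have cont\<Phi>: "continuous_on (path_image q) \<Phi>"
    unfolding qim
    by (intro continuous_on_closed_Un closed_Un closed_path_image cont1 cont2 cont3 r(1) e(1) pfr)
  have fr: "path_image (f \<circ> r) \<subseteq> G \<union> {y}"
  proof
    fix z assume "z \<in> path_image (f \<circ> r)"
    then obtain t where t: "t \<in> {0..1}" "z = f (r t)" by (auto simp: path_image_def)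
    then show "z \<in> G \<union> {y}" using rG[of t] fG by (cases "t = 1") (auto simp: r y_def)
  qed
  have "path_image q \<subseteq> G \<union> {x, y}"
    unfolding qim using seg r(4) e(2) fr by blast
  then have \<gamma>sub: "path_image \<gamma> \<subseteq> G \<union> {x, y}" using \<gamma>(2) by blast
  have inj: "inj_on \<Phi> (G \<union> {x, y})"
  proof -
    have 1: "inj_on \<phi> G" using \<psi>\<phi> by (metis inj_onI)
    have G1: "norm (\<Phi> z) < 1" if "z \<in> G" for z using \<phi>[OF that] \<Phi>G[OF that] by simp
    have eq: "z = w" if "\<Phi> z = \<Phi> w" "z \<in> G \<union> {x, y}" "w \<in> G \<union> {x, y}" for z w
    proof (cases "z \<in> G")
      case True
      then have "norm (\<Phi> w) < 1" using G1 that(1) by metis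
      then have "w \<in> G" using that(3) \<Phi>xy \<zeta>(1) c\<zeta>(2) by auto
      then show ?thesis using True that(1) \<Phi>G 1 by (auto dest: inj_onD)
    next
      case False
      then have "norm (\<Phi> z) = 1" using that(2) \<Phi>xy \<zeta>(1) c\<zeta>(2) by auto
      then have "w \<notin> G" using G1[of w] that(1) by auto
      then show ?thesis using False that \<Phi>xy c\<zeta>(1) by auto
    qed
    then show ?thesis by (rule inj_onI)
  qed
  have arc\<alpha>: "arc (\<Phi> \<circ> \<gamma>)"
    unfolding arc_def
  proof
    show "path (\<Phi> \<circ> \<gamma>)"
      using \<gamma>(1,2) cont\<Phi> by (intro path_continuous_image) (auto simp: arc_def intro: continuous_on_subset)
    show "inj_on (\<Phi> \<circ> \<gamma>) {0..1}"
      using \<gamma>(1) inj_on_subset[OF inj \<gamma>sub] by (intro comp_inj_on) (auto simp: arc_def path_image_def)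
  qed
  have im: "path_image (\<Phi> \<circ> \<gamma>) = \<Phi> ` path_image \<gamma>" by (rule path_image_compose)
  show thesis
  proof
    show "arc \<gamma>" by fact
    show "pathstart \<gamma> \<in> frontier G" "pathfinish \<gamma> \<in> frontier G" using \<gamma> x y by auto
    show "path_image \<gamma> \<subseteq> G \<union> {pathstart \<gamma>, pathfinish \<gamma>}" using \<gamma>sub \<gamma> by simp
    show "arc (\<Phi> \<circ> \<gamma>)" by fact
    show "\<phi> z \<in> path_image (\<Phi> \<circ> \<gamma>)" if "z \<in> path_image \<gamma> \<inter> G" for z
      unfolding im using \<Phi>G[of z] that by (metis IntD1 IntD2 image_eqI)
    show "\<psi> w \<in> path_image \<gamma>" if w: "w \<in> path_image (\<Phi> \<circ> \<gamma>) \<inter> ball 0 1" for w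
    proof -
      obtain z where z: "z \<in> path_image \<gamma>" "w = \<Phi> z" using w unfolding im by blast
      then have "z \<in> G" using w \<gamma>sub \<Phi>xy \<zeta>(1) c\<zeta>(2) by auto
      then show ?thesis using z \<Phi>G \<psi>\<phi> by simp
    qed
  qed
qed

text \<open>Let \<open>S\<close> be the side of the crosscut whose frontier meets that of \<open>G\<close> only in the arc \<open>A\<close>. A
  point \<open>x\<close> of the frontier is a limit of points of \<open>G\<close> whose \<open>\<phi>\<close>-images tend to a point of the
  circle; after a rotation from a finite list, these images lie in \<open>\<phi> ` S\<close>. So \<open>x\<close> is the image,
  under an iterate from a finite list, of a limit of points of \<open>S\<close> on the frontier, that is of a
  point of \<open>A\<close>.\<close>

lemma frontier_finite_union_of_path_images:
  obtains A N where "path A" "path_image A \<subseteq> frontier G"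
    "frontier G \<subseteq> (\<Union>n<N. (f ^^ n) ` path_image A)"
proof -
  obtain \<gamma> \<alpha> where \<gamma>: "arc \<gamma>" "pathstart \<gamma> \<in> frontier G" "pathfinish \<gamma> \<in> frontier G"
    "path_image \<gamma> \<subseteq> G \<union> {pathstart \<gamma>, pathfinish \<gamma>}" and \<alpha>: "arc \<alpha>"
    "\<And>z. z \<in> path_image \<gamma> \<inter> G \<Longrightarrow> \<phi> z \<in> path_image \<alpha>"
    "\<And>w. w \<in> path_image \<alpha> \<inter> ball 0 1 \<Longrightarrow> \<psi> w \<in> path_image \<gamma>"
    by (rule landing_crosscut, rule that; assumption)
  have ne: "pathstart \<gamma> \<noteq> pathfinish \<gamma>" using \<gamma>(1) arc_distinct_ends by metis
  obtain a where a: "path a" "path_image a \<subseteq> frontier G" "pathstart a = pathfinish \<gamma>" "pathfinish a = pathstart \<gamma>"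
    using pc \<gamma>(2,3) unfolding path_connected_def by blast
  obtain A where A: "arc A" "path_image A \<subseteq> path_image a" "pathstart A = pathfinish \<gamma>" "pathfinish A = pathstart \<gamma>"
    using path_contains_arc[OF a(1,3,4)] ne by metis
  have AX: "path_image A \<subseteq> frontier G" using A(2) a(2) by blast
  obtain S where S: "open S" "connected S" "S \<noteq> {}" "S \<subseteq> G" "frontier S = path_image \<gamma> \<union> path_image A"
    using crosscut_side[OF openG B(1,3,4) \<gamma>(1) refl refl \<gamma>(4) A(1,3,4) AX] by blast
  have SC: "S \<inter> frontier S = {}" using S(1) by (auto simp: frontier_def interior_open)
  define V where "V = ball 0 1 \<inter> \<psi> -` S"
  have V: "open V" "V \<subseteq> ball 0 1"
    unfolding V_def using continuous_open_preimage[OF cont\<psi> open_ball S(1)] by (auto simp: Int_commute)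
  have "V \<noteq> {}"
  proof -
    obtain s where "s \<in> S" using S(3) by blast
    then have "\<phi> s \<in> V" using S(4) \<phi> \<psi>\<phi> unfolding V_def by (metis IntI subsetD vimageI)
    then show ?thesis by blast
  qed
  \<comment> \<open>\<open>\<alpha>\<close> in the disk corresponds to \<open>\<gamma>\<close> in \<open>G\<close>, and \<open>\<gamma>\<close> is part of the frontier of the open set \<open>S\<close>.\<close>
  have disj: "V \<inter> path_image \<alpha> = {}"
  proof -
    have False if "w \<in> V" "w \<in> path_image \<alpha>" for w
    proof -
      have "\<psi> w \<in> S" "\<psi> w \<in> path_image \<gamma>" using that V(2) \<alpha>(3)[of w] by (auto simp: V_def)
      then show False using SC S(5) by blast
    qed
    then show ?thesis by blast
  qed
  have fr: "frontier V \<inter> ball 0 1 \<subseteq> path_image \<alpha>"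
  proof
    fix w assume w: "w \<in> frontier V \<inter> ball 0 1"
    then have wb: "w \<in> ball 0 1" and wc: "w \<in> closure V" and "w \<notin> V"
      using V(1) by (auto simp: frontier_def interior_open)
    obtain v where v: "\<And>n. v n \<in> V" "v \<longlonglongrightarrow> w" using wc closure_sequential[of w V] by blast
    have "(\<lambda>n. \<psi> (v n)) \<longlonglongrightarrow> \<psi> w"
      using cont\<psi> v wb V(2) unfolding continuous_on_sequentially o_def by blast
    moreover have "\<psi> (v n) \<in> S" for n using v(1) by (auto simp: V_def)
    ultimately have "\<psi> w \<in> closure S"
      by (intro closure_sequential[THEN iffD2] exI[of _ "\<lambda>n. \<psi> (v n)"]) auto
    moreover have "\<psi> w \<notin> S" using \<open>w \<notin> V\<close> wb by (auto simp: V_def)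
    ultimately have "\<psi> w \<in> frontier S" using S(1) by (simp add: frontier_def interior_open)
    moreover have "\<psi> w \<in> G" using \<psi>[OF wb] .
    ultimately have "\<psi> w \<in> path_image \<gamma> \<inter> G" using S(5) AX G_Int_frontier by blast
    then show "w \<in> path_image \<alpha>" using \<alpha>(2) \<phi>\<psi>[OF wb] by metis
  qed
  obtain \<xi> \<epsilon> where \<xi>: "norm \<xi> = 1" "\<epsilon> > 0" "ball \<xi> \<epsilon> \<inter> ball 0 1 \<subseteq> V"
    using crosscut_complement_contains_sector[OF V(1) \<open>V \<noteq> {}\<close> V(2) \<alpha>(1) disj fr] by blast
  obtain N where N: "\<And>\<eta>. norm \<eta> = 1 \<Longrightarrow> \<exists>n<N. dist (c ^ n * \<xi>) \<eta> < \<epsilon>"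
    using finitely_many_rotations_cover_circle[OF c1 c_irr \<xi>(1,2)] by blast
  have "x \<in> (\<Union>n<N. (f ^^ n) ` path_image A)" if x: "x \<in> frontier G" for x
  proof -
    obtain z where z: "\<And>k. z k \<in> G" "z \<longlonglongrightarrow> x" using frontier_seq[OF x] by blast
    note nz = \<phi>_tends_to_circle[OF z x]
    have "\<phi> (z k) \<in> cball 0 1" for k using \<phi>[OF z(1), of k] by simp
    then obtain \<eta> \<sigma> where \<sigma>: "strict_mono (\<sigma> :: nat \<Rightarrow> nat)" "((\<lambda>k. \<phi> (z k)) \<circ> \<sigma>) \<longlonglongrightarrow> \<eta>"
      using compact_cball[of "0::complex" 1] unfolding compact_def by metis
    have "((\<lambda>k. norm (\<phi> (z k))) \<circ> \<sigma>) \<longlonglongrightarrow> 1" using nz \<sigma>(1) LIMSEQ_subseq_LIMSEQ by blast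
    moreover have "((\<lambda>k. norm (\<phi> (z k))) \<circ> \<sigma>) \<longlonglongrightarrow> norm \<eta>" using tendsto_norm[OF \<sigma>(2)] by (simp add: o_def)
    ultimately have "norm \<eta> = 1" using LIMSEQ_unique by blast
    then obtain n where n: "n < N" "dist (c ^ n * \<xi>) \<eta> < \<epsilon>" using N by blast
    have cn: "norm (c ^ n) = 1" using c1 by (simp add: norm_power)
    then have cn0: "c ^ n \<noteq> 0" by (metis norm_zero zero_neq_one)
    \<comment> \<open>The \<open>n\<close>-th iterate acts as the rotation by \<open>c ^ n\<close>, so undoing this rotation moves the limit
      point \<open>\<eta>\<close> into the arc at \<open>\<xi>\<close>.\<close>
    define w where "w k = \<phi> (z (\<sigma> k)) / c ^ n" for k
    have wball: "w k \<in> ball 0 1" for k using \<phi>[OF z(1), of "\<sigma> k"] cn by (simp add: w_def norm_divide)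
    have cw: "c ^ n * w k = \<phi> (z (\<sigma> k))" for k using cn0 by (simp add: w_def)
    have "eventually (\<lambda>k. dist (\<phi> (z (\<sigma> k))) \<eta> < \<epsilon> - dist (c ^ n * \<xi>) \<eta>) sequentially"
      using tendstoD[OF \<sigma>(2), of "\<epsilon> - dist (c ^ n * \<xi>) \<eta>"] n(2) by simp
    then obtain K where K: "\<And>k. k \<ge> K \<Longrightarrow> dist (\<phi> (z (\<sigma> k))) \<eta> < \<epsilon> - dist (c ^ n * \<xi>) \<eta>"
      by (auto simp: eventually_sequentially)
    have wV: "w k \<in> V" if "k \<ge> K" for k
    proof -
      have "dist (c ^ n * \<xi>) (c ^ n * w k) < \<epsilon>"
        using K[OF that] dist_triangle2[of "c ^ n * \<xi>" "c ^ n * w k" \<eta>] unfolding cw by linarith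
      moreover have "dist (c ^ n * \<xi>) (c ^ n * w k) = dist \<xi> (w k)"
        using cn by (simp add: dist_norm right_diff_distrib[symmetric] norm_mult)
      ultimately show ?thesis using \<xi>(3) wball by auto
    qed
    define s where "s k = \<psi> (w (k + K))" for k
    have sS: "s k \<in> S" for k using wV[of "k + K"] by (simp add: s_def V_def)
    have fs: "(f ^^ n) (s k) = z (\<sigma> (k + K))" for k
    proof -
      have sG: "s k \<in> G" using sS S(4) by blast
      have "\<phi> ((f ^^ n) (s k)) = \<phi> (z (\<sigma> (k + K)))"
        using funpow_G[OF sG, of n] \<phi>\<psi>[OF wball, of "k + K"] cw by (simp add: s_def)
      then show ?thesis using \<psi>\<phi>[OF z(1)] \<psi>\<phi> funpow_G[OF sG, of n] by metis
    qed
    have "compact (closure S)" using bddG S(4) bounded_subset compact_closure by blast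
    moreover have "s k \<in> closure S" for k using sS closure_subset by blast
    ultimately obtain u \<tau> where \<tau>: "u \<in> closure S" "strict_mono (\<tau> :: nat \<Rightarrow> nat)" "(s \<circ> \<tau>) \<longlonglongrightarrow> u"
      unfolding compact_def by metis
    have sub: "strict_mono (\<lambda>k. \<sigma> (\<tau> k + K))"
      using \<sigma>(1) \<tau>(2) by (simp add: strict_mono_def)
    have "(\<lambda>k. (f ^^ n) (s (\<tau> k))) \<longlonglongrightarrow> (f ^^ n) u"
      using cont_funpow[of n] \<tau>(3) unfolding continuous_on_sequentially o_def by blast
    moreover have "(\<lambda>k. (f ^^ n) (s (\<tau> k))) \<longlonglongrightarrow> x"
      using LIMSEQ_subseq_LIMSEQ[OF z(2) sub] by (simp add: fs o_def)
    ultimately have xu: "x = (f ^^ n) u" using LIMSEQ_unique by blast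
    have "u \<in> frontier G"
    proof (rule frontierI[of "\<lambda>k. s (\<tau> k)"])
      show "s (\<tau> k) \<in> G" for k using sS S(4) by blast
      show "(\<lambda>k. s (\<tau> k)) \<longlonglongrightarrow> u" using \<tau>(3) by (simp add: o_def)
      have "norm (\<phi> (s (\<tau> k))) = norm (\<phi> (z (\<sigma> (\<tau> k + K))))" for k
        using \<phi>\<psi>[OF wball, of "\<tau> k + K"] cn by (simp add: s_def w_def norm_divide)
      then show "(\<lambda>k. norm (\<phi> (s (\<tau> k)))) \<longlonglongrightarrow> 1"
        using LIMSEQ_subseq_LIMSEQ[OF nz sub] by (simp add: o_def)
    qed
    then have "u \<notin> S" using S(4) G_Int_frontier by blast
    then have "u \<in> frontier S" using \<tau>(1) S(1) by (simp add: frontier_def interior_open)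
    then have "u \<in> path_image A"
      using S(5) \<gamma>(4) \<open>u \<in> frontier G\<close> G_Int_frontier A(3,4) pathstart_in_path_image[of A] pathfinish_in_path_image[of A] by auto
    then show ?thesis using xu n(1) by blast
  qed
  then have "frontier G \<subseteq> (\<Union>n<N. (f ^^ n) ` path_image A)" by blast
  then show thesis using that[of A N] arc_imp_path[OF A(1)] AX by blast
qed

text \<open>Path connectedness allows the finitely many paths to be joined into one path onto the frontier.
  The component of \<open>\<psi> 0\<close> in its complement is bounded, because it is contained in \<open>G\<close>.\<close>

theorem frontier_is_simple_closed_curve:
  "\<exists>J. simple_path J \<and> pathfinish J = pathstart J \<and> path_image J = frontier G"
proof -
  obtain A N where A: "path A" "path_image A \<subseteq> frontier G"
    and cover: "frontier G \<subseteq> (\<Union>n<N. (f ^^ n) ` path_image A)"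
    by (rule frontier_finite_union_of_path_images)
  have "frontier G \<noteq> {}" using frontier_not_finite by auto
  moreover have "path ((f ^^ n) \<circ> A) \<and> path_image ((f ^^ n) \<circ> A) \<subseteq> frontier G" for n
    using A funpow_frontier continuous_on_subset[OF cont_funpow]
    by (auto simp: path_image_compose intro!: path_continuous_image)
  ultimately obtain \<gamma> where \<gamma>: "path \<gamma>" "path_image \<gamma> \<subseteq> frontier G"
      "\<forall>n<N. path_image ((f ^^ n) \<circ> A) \<subseteq> path_image \<gamma>"
    using finite_union_of_paths_in_path[OF pc, of N "\<lambda>n. (f ^^ n) \<circ> A"] by blast
  have \<gamma>eq: "path_image \<gamma> = frontier G"
  proof
    have "(f ^^ n) ` path_image A \<subseteq> path_image \<gamma>" if "n < N" for n
      using \<gamma>(3) that unfolding path_image_compose by blast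
    then show "frontier G \<subseteq> path_image \<gamma>" using cover by blast
  qed (rule \<gamma>(2))
  let ?a = "\<psi> 0"
  have "connected_component_set (- frontier G) ?a \<subseteq> G"
  proof (rule ccontr)
    assume "\<not> ?thesis"
    have "?a \<in> connected_component_set (- frontier G) ?a"
      using G_nonempty G_Int_frontier by auto
    with \<open>\<not> connected_component_set (- frontier G) ?a \<subseteq> G\<close> have "connected_component_set (- frontier G) ?a \<inter> frontier G \<noteq> {}"
      using G_nonempty connected_Int_frontier[OF connected_connected_component, of _ _ G] by blast
    then show False using connected_component_subset[of "- frontier G" ?a] by blast
  qed
  then have "bounded (connected_component_set (- path_image \<gamma>) ?a)"
    unfolding \<gamma>eq using bddG bounded_subset by blast
  moreover have "?a \<notin> path_image \<gamma>" using \<gamma>eq G_nonempty G_Int_frontier by blast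
  ultimately obtain J where J: "simple_path J" "pathfinish J = pathstart J" "path_image J \<subseteq> frontier G"
      "?a \<in> inside (path_image J)"
    using path_image_separating_contains_loop[OF \<gamma>(1), of ?a] unfolding \<gamma>eq by blast
  then have "path_image J = frontier G"
    using loop_is_common_frontier[OF J(1-3) G_nonempty J(4) openG connG B] by blast
  then show ?thesis using J by blast
qed

end

section \<open>The Riemann sphere and the iterates of a polynomial\<close>

text \<open>The inverse of \<^const>\<open>Fin\<close>; its value at infinity is arbitrary.\<close>

definition finite_part :: "riemann_sphere \<Rightarrow> complex" where
  "finite_part p = (case p of Fin z \<Rightarrow> z | Infty \<Rightarrow> 0)"

lemma finite_part_Fin [simp]: "finite_part (Fin z) = z"
  by (simp add: finite_part_def)

lemma inj_Fin: "inj Fin" by (auto intro: injI)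

lemma range_Fin: "range Fin = - {Infty}"
  by (auto intro: riemann_sphere.exhaust)

lemma continuous_on_stereo: "continuous_on A stereo"
  unfolding continuous_on_iff by (auto simp: dist_riemann_sphere_def)

lemma continuous_on_Fin: "continuous_on A Fin"
proof -
  have "continuous_on A (\<lambda>z. stereo (Fin z))"
    unfolding stereo.simps using norm_sq_plus_one_pos
    by (intro continuous_intros) (metis less_irrefl)+
  then show ?thesis
    unfolding continuous_on_iff by (simp add: dist_riemann_sphere_def)
qed

text \<open>The inverse stereographic projection is \<open>z = w / (1 - t)\<close> at the point \<open>(w, t)\<close> of the unit
  sphere.\<close>

lemma continuous_on_finite_part: "continuous_on (- {Infty}) finite_part"
proof -
  have pos: "(cmod z)\<^sup>2 + 1 \<noteq> 0" for z using norm_sq_plus_one_pos[of z] by simp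
  have snd1: "1 - snd (stereo (Fin z)) = 2 / ((cmod z)\<^sup>2 + 1)" for z
    using pos[of z] by (simp add: field_simps)
  have "continuous_on (- {Infty}) (\<lambda>p. fst (stereo p) / of_real (1 - snd (stereo p)))"
  proof (intro continuous_intros continuous_on_stereo ballI)
    fix p assume "p \<in> - {Infty}"
    then obtain z where "p = Fin z" using range_Fin by blast
    have "1 - snd (stereo p) \<noteq> 0" unfolding \<open>p = Fin z\<close> snd1 using pos[of z] by simp
    then show "complex_of_real (1 - snd (stereo p)) \<noteq> 0" by (simp only: of_real_eq_0_iff not_False_eq_True)
  qed
  then show ?thesis
  proof (rule continuous_on_eq)
    fix p assume "p \<in> - {Infty}"
    then obtain z where p: "p = Fin z" using range_Fin by blast
    have "complex_of_real (2 / ((cmod z)\<^sup>2 + 1)) \<noteq> 0" using pos[of z] by (simp only: of_real_eq_0_iff) simp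
    then show "fst (stereo p) / of_real (1 - snd (stereo p)) = finite_part p"
      unfolding p snd1 by simp
  qed
qed

lemma homeomorphism_Fin: "homeomorphism A (Fin ` A) Fin finite_part"
  by (rule homeomorphismI) (auto intro: continuous_on_Fin continuous_on_subset[OF continuous_on_finite_part])

lemma open_Fin_image: assumes "open U" shows "open (Fin ` U)"
proof -
  have "open (- {Infty :: riemann_sphere})" by (simp add: open_Compl)
  then have "open (- {Infty} \<inter> finite_part -` U)"
    using continuous_open_preimage[OF continuous_on_finite_part _ assms] by blast
  moreover have "- {Infty} \<inter> finite_part -` U = Fin ` U"
    using range_Fin by (auto simp: image_iff) (metis finite_part_Fin riemann_sphere.exhaust)
  ultimately show ?thesis by simp
qed

lemma open_Fin_vimage: "open U \<Longrightarrow> open (Fin -` U)"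
  using continuous_on_Fin[of UNIV] by (simp add: open_vimage)

lemma closure_Fin_image:
  assumes "bounded A"
  shows "closure (Fin ` A) = Fin ` closure A"
proof
  have "compact (Fin ` closure A)"
    using assms by (intro compact_continuous_image continuous_on_Fin) (simp add: compact_closure)
  then have "closed (Fin ` closure A)" by (rule compact_imp_closed)
  then show "closure (Fin ` A) \<subseteq> Fin ` closure A"
    using closure_subset by (intro closure_minimal) auto
  show "Fin ` closure A \<subseteq> closure (Fin ` A)"
    by (rule image_closure_subset[OF continuous_on_Fin closed_closure closure_subset])
qed

lemma frontier_Fin_image:
  assumes "bounded A" "open A"
  shows "frontier (Fin ` A) = Fin ` frontier A"
  using assms by (simp add: frontier_def closure_Fin_image interior_open open_Fin_image image_set_diff inj_Fin)

lemma poly_sphere_funpow_Fin: "(poly_sphere f ^^ n) (Fin z) = Fin ((poly f ^^ n) z)"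
  by (induction n) simp_all

lemma escape_radius:
  fixes f :: "complex poly"
  assumes "degree f \<ge> 2"
  obtains R where "R > 0" "\<And>z. norm z > R \<Longrightarrow> norm (poly f z) \<ge> 2 * norm z"
proof -
  obtain a q where f: "f = pCons a q" by (cases f)
  have q: "degree q \<ge> 1" using assms by (auto simp: f split: if_splits)
  then have "filterlim (poly q) at_infinity at_infinity"
    by (intro filterlim_poly_at_infinity) simp
  then have "eventually (\<lambda>z. 3 \<le> norm (poly q z)) at_infinity"
    using filterlim_at_infinity[of 0 "poly q"] by simp
  then obtain b where b: "\<And>z::complex. norm z \<ge> b \<Longrightarrow> 3 \<le> norm (poly q z)" by (auto simp: eventually_at_infinity)
  show thesis
  proof (rule that[of "max 1 (max b (norm a))"])
    fix z :: complex assume "norm z > max 1 (max b (norm a))"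
    then have z: "norm z \<ge> b" "norm z \<ge> norm a" by auto
    have "3 * norm z \<le> norm (z * poly q z)"
      using mult_right_mono[OF b[OF z(1)], of "norm z"] by (simp add: norm_mult mult.commute)
    also have "\<dots> \<le> norm (a + z * poly q z) + norm a"
      using norm_triangle_ineq4[of "a + z * poly q z" a] by simp
    finally show "2 * norm z \<le> norm (poly f z)" using z(2) by (simp add: f)
  qed simp
qed

lemma holomorphic_on_poly_funpow: "(poly f ^^ n) holomorphic_on A"
proof (induction n)
  case (Suc n)
  then show ?case
    by (simp add: o_def) (intro holomorphic_on_compose_gen[unfolded o_def, of "poly f ^^ n" A "poly f" UNIV] holomorphic_intros; simp)
qed (simp add: id_def)

text \<open>Montel's theorem gives locally uniform convergence in the Euclidean metric. As all values stay in
  a compact disk, on which \<^const>\<open>Fin\<close> is uniformly continuous, this is also convergence in the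
  chordal metric.\<close>

lemma bounded_iterates_in_fatou_set:
  assumes "r > 0" and bdd: "\<And>z n. z \<in> ball x r \<Longrightarrow> norm ((poly f ^^ n) z) \<le> R"
  shows "Fin x \<in> fatou_set f"
proof -
  let ?U = "Fin ` ball x r"
  have "normal_family_on ?U (range (\<lambda>n. poly_sphere f ^^ n))"
    unfolding normal_family_on_def
  proof (intro allI impI)
    fix g :: "nat \<Rightarrow> riemann_sphere \<Rightarrow> riemann_sphere"
    assume "range g \<subseteq> range (\<lambda>n. poly_sphere f ^^ n)"
    then have "\<forall>k. \<exists>m. g k = poly_sphere f ^^ m" by (auto simp: image_subset_iff image_iff)
    then obtain m where m: "\<And>k. g k = poly_sphere f ^^ m k" by metis
    obtain h \<sigma> where h: "h holomorphic_on ball x r" "strict_mono \<sigma>"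
      "\<And>z. z \<in> ball x r \<Longrightarrow> (\<lambda>k. (poly f ^^ m (\<sigma> k)) z) \<longlonglongrightarrow> h z"
      "\<And>K. \<lbrakk>compact K; K \<subseteq> ball x r\<rbrakk> \<Longrightarrow> uniform_limit K ((\<lambda>k. poly f ^^ m k) \<circ> \<sigma>) h sequentially"
    proof (rule Montel[of "ball x r" "range (\<lambda>n. poly f ^^ n)" "\<lambda>k. poly f ^^ m k"])
      show "\<exists>B. \<forall>h\<in>range (\<lambda>n. poly f ^^ n). \<forall>z\<in>K. norm (h z) \<le> B" if "K \<subseteq> ball x r" for K
        using bdd that by (intro exI[of _ R]) auto
      show "\<And>h. h \<in> range (\<lambda>n. poly f ^^ n) \<Longrightarrow> h holomorphic_on ball x r"
        using holomorphic_on_poly_funpow by auto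
    qed auto
    define h' where "h' p = Fin (h (finite_part p))" for p
    have hR: "norm (h z) \<le> R" if "z \<in> ball x r" for z
      using h(3)[OF that] bdd[OF that] by (intro Lim_norm_ubound[OF _ h(3)[OF that]]) auto
    have unif: "uniformly_continuous_on (cball 0 R) Fin"
      by (intro compact_uniformly_continuous continuous_on_Fin) simp
    have "uniform_limit K (g \<circ> \<sigma>) h' sequentially" if K: "compact K" "K \<subseteq> ?U" for K
    proof -
      define K0 where "K0 = finite_part ` K"
      have K0: "K0 \<subseteq> ball x r" "K = Fin ` K0" using K(2) unfolding K0_def by force+
      have "compact K0"
        unfolding K0_def using K by (intro compact_continuous_image continuous_on_subset[OF continuous_on_finite_part]) auto
      then have u: "uniform_limit K0 ((\<lambda>k. poly f ^^ m k) \<circ> \<sigma>) h sequentially" using h(4) K0(1) by blast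
      show ?thesis
        unfolding uniform_limit_iff
      proof (intro allI impI)
        fix e :: real assume "e > 0"
        then obtain d where d: "d > 0" "\<And>a b. norm a \<le> R \<Longrightarrow> norm b \<le> R \<Longrightarrow> dist a b < d \<Longrightarrow> dist (Fin a) (Fin b) < e"
          using unif unfolding uniformly_continuous_on_def by (auto simp: dist_commute)
        have "eventually (\<lambda>k. \<forall>z\<in>K0. dist ((poly f ^^ m (\<sigma> k)) z) (h z) < d) sequentially"
          using u d(1) unfolding uniform_limit_iff by (auto simp: o_def)
        then show "eventually (\<lambda>k. \<forall>p\<in>K. dist ((g \<circ> \<sigma>) k p) (h' p) < e) sequentially"
        proof eventually_elim
          case (elim k)
          show ?case
          proof
            fix p assume "p \<in> K"
            then obtain z where z: "z \<in> K0" "p = Fin z" using K0(2) by blast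
            have "dist (Fin ((poly f ^^ m (\<sigma> k)) z)) (Fin (h z)) < e"
              using elim z(1) K0(1) bdd hR by (intro d(2)) auto
            then show "dist ((g \<circ> \<sigma>) k p) (h' p) < e"
              by (simp add: m poly_sphere_funpow_Fin z(2) h'_def)
          qed
        qed
      qed
    qed
    then show "\<exists>r h. strict_mono r \<and> (\<forall>K. compact K \<and> K \<subseteq> ?U \<longrightarrow> uniform_limit K (g \<circ> r) h sequentially)"
      using h(2) by blast
  qed
  then show ?thesis
    unfolding fatou_set_def using open_Fin_image[OF open_ball, of x r] \<open>r > 0\<close>
    by (intro CollectI exI[of _ ?U]) auto
qed

lemma funpow_poly_eq_poly:
  fixes f :: "complex poly"
  obtains p where "poly f ^^ n = poly p" "degree p = degree f ^ n"
proof -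
  have "\<exists>p. poly f ^^ n = poly p \<and> degree p = degree f ^ n"
  proof (induction n)
    case 0
    show ?case by (intro exI[of _ "[:0, 1:]"]) (auto simp: fun_eq_iff)
  next
    case (Suc n)
    then obtain p where "poly f ^^ n = poly p" "degree p = degree f ^ n" by blast
    then show ?case by (intro exI[of _ "pcompose f p"]) (auto simp: fun_eq_iff poly_pcompose degree_pcompose)
  qed
  then show thesis using that by blast
qed

lemma finite_periodic_points:
  fixes f :: "complex poly"
  assumes "degree f \<ge> 2" "n > 0"
  shows "finite {z. (poly f ^^ n) z = z}"
proof -
  obtain p where p: "poly f ^^ n = poly p" "degree p = degree f ^ n" by (rule funpow_poly_eq_poly)
  have "degree f ^ 1 \<le> degree f ^ n" using assms by (intro power_increasing) auto
  then have "degree p \<ge> 2" using assms p(2) by simp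
  then have "p \<noteq> [:0, 1:]" by auto
  then have "finite {z. poly (p - [:0, 1:]) z = 0}" by (intro poly_roots_finite) simp
  then show ?thesis by (simp add: p(1))
qed

lemma open_fatou_set: "open (fatou_set f)"
proof -
  have "fatou_set f = \<Union>{U. open U \<and> normal_family_on U (range (\<lambda>n. poly_sphere f ^^ n))}"
    unfolding fatou_set_def by blast
  then show ?thesis by auto
qed

lemma path_connected_of_arcwise_connected_Fin:
  assumes "arcwise_connected (Fin ` A)"
  shows "path_connected A"
  unfolding path_connected_def
proof (intro ballI)
  fix x y assume xy: "x \<in> A" "y \<in> A"
  show "\<exists>g. path g \<and> path_image g \<subseteq> A \<and> pathstart g = x \<and> pathfinish g = y"
  proof (cases "x = y")
    case True
    then show ?thesis using xy by (intro exI[of _ "\<lambda>_. x"]) (auto simp: path_def pathstart_def pathfinish_def path_image_def)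
  next
    case False
    then obtain g where g: "arc g" "path_image g \<subseteq> Fin ` A" "pathstart g = Fin x" "pathfinish g = Fin y"
      using assms xy unfolding arcwise_connected_def by (metis image_eqI riemann_sphere.inject)
    have "path (finite_part \<circ> g)"
      using g(1,2) range_Fin
      by (intro path_continuous_image continuous_on_subset[OF continuous_on_finite_part]) (auto simp: arc_imp_path)
    moreover have "path_image (finite_part \<circ> g) \<subseteq> A" using g(2) by (force simp: path_image_compose)
    ultimately show ?thesis using g(3,4) by (intro exI[of _ "finite_part \<circ> g"]) (simp add: pathstart_compose pathfinish_compose)
  qed
qed

text \<open>If \<open>c ^ n = 1\<close>, the \<open>n\<close>-th iterate is the identity on the infinite set \<open>G\<close>, but a polynomial of
  degree at least two has only finitely many points of period \<open>n\<close>.\<close>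

lemma siegel_disk_multiplier_not_root_of_unity:
  assumes "degree f \<ge> 2" "infinite G" "poly_sphere f ` G = G" "inj_on \<phi> G"
    and conj: "\<And>p. p \<in> G \<Longrightarrow> \<phi> (poly_sphere f p) = c * \<phi> p" and "n > 0"
  shows "c ^ n \<noteq> (1::complex)"
proof
  assume "c ^ n = 1"
  have iter: "(poly_sphere f ^^ k) p \<in> G \<and> \<phi> ((poly_sphere f ^^ k) p) = c ^ k * \<phi> p" if "p \<in> G" for k p
    using that assms(3) by (induction k) (auto simp: conj)
  have "(poly f ^^ n) z = z" if "Fin z \<in> G" for z
    using iter[OF that, of n] \<open>c ^ n = 1\<close> that assms(4)
    by (auto simp: poly_sphere_funpow_Fin dest: inj_onD)
  then have "Fin -` G \<subseteq> {z. (poly f ^^ n) z = z}" by auto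
  then have "finite (Fin -` G)" using finite_periodic_points[OF assms(1,6)] finite_subset by blast
  then have "finite (insert Infty (Fin ` (Fin -` G)))" by (intro finite.insertI finite_imageI)
  moreover have "G \<subseteq> insert Infty (Fin ` (Fin -` G))" by (metis (no_types, lifting) image_eqI insert_iff riemann_sphere.exhaust subsetI vimageI)
  ultimately show False using assms(2) finite_subset by blast
qed

text \<open>Close to a point of the Julia set some iterate exceeds the bound \<open>R\<close>. By the maximum principle
  this cannot happen in a bounded component of the complement of \<open>closure A\<close>.\<close>

lemma outside_accumulates_at_julia_points:
  fixes f :: "complex poly"
  assumes "bounded A" "Fin x \<notin> fatou_set f" and bdd: "\<And>z n. z \<in> closure A \<Longrightarrow> norm ((poly f ^^ n) z) \<le> R"
  shows "x \<in> closure (outside (closure A))"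
  unfolding closure_approachable
proof (intro allI impI)
  fix e :: real assume "e > 0"
  then obtain z n where z: "z \<in> ball x e" "norm ((poly f ^^ n) z) > R"
    using bounded_iterates_in_fatou_set[of e x f R] assms(2) by (meson not_le)
  have "z \<notin> closure A" using z(2) bdd by (meson not_le)
  moreover have "z \<notin> inside (closure A)"
  proof
    assume zi: "z \<in> inside (closure A)"
    have "norm ((poly f ^^ n) z) \<le> R"
    proof (rule maximum_modulus_frontier[where S = "inside (closure A)" and f = "poly f ^^ n" and \<xi> = z])
      show "(poly f ^^ n) holomorphic_on interior (inside (closure A))" by (rule holomorphic_on_poly_funpow)
      show "continuous_on (closure (inside (closure A))) (poly f ^^ n)"
        by (intro holomorphic_on_imp_continuous_on holomorphic_on_poly_funpow)
      show "bounded (inside (closure A))" using assms(1) by (intro bounded_inside bounded_closure)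
      show "norm ((poly f ^^ n) w) \<le> R" if "w \<in> frontier (inside (closure A))" for w
        using that frontier_inside_subset[of "closure A"] bdd by auto
    qed (rule zi)
    then show False using z(2) by simp
  qed
  ultimately have "z \<in> outside (closure A)" using inside_Un_outside[of "closure A"] by blast
  then show "\<exists>y\<in>outside (closure A). dist y x < e" using z(1) by (auto simp: dist_commute)
qed

section \<open>The boundary of a Siegel disk\<close>

theorem corollary1p3:
  fixes f :: "complex poly" and G :: "riemann_sphere set"
  assumes "degree f \<ge> 2"
    and "siegel_disk f G"
    and "arcwise_connected (frontier G)"
  shows "jordan_curve (frontier G)"
proof -
  let ?F = "poly f"
  obtain w\<^sub>0 where comp: "G \<in> components (fatou_set f)" and fGG: "poly_sphere f ` G = G"
      and w0: "Fin w\<^sub>0 \<in> G" "?F w\<^sub>0 = w\<^sub>0" and rot: "conjugate_to_rotation_on (poly_sphere f) G"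
    using assms(2) unfolding siegel_disk_def by blast
  obtain \<Phi> c where c1: "norm c = 1" and hol: "sphere_holomorphic_on \<Phi> G" and bij: "bij_betw \<Phi> G (ball 0 1)"
      and conj: "\<And>p. p \<in> G \<Longrightarrow> \<Phi> (poly_sphere f p) = c * \<Phi> p"
    using rot unfolding conjugate_to_rotation_on_def by blast
  have injG: "inj_on \<Phi> G" using bij by (rule bij_betw_imp_inj_on)
  have "infinite G"
    using bij_betw_finite[OF bij] uncountable_ball[of 1 "0::complex"] uncountable_infinite by auto
  note c_irr = siegel_disk_multiplier_not_root_of_unity[OF assms(1) this fGG injG conj]
  have "c \<noteq> 1" using c_irr[of 1] by simp
  then have fix0: "\<Phi> p = 0" if "p \<in> G" "poly_sphere f p = p" for p using conj[OF that(1)] that(2) by auto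
  \<comment> \<open>Infinity is fixed, like \<open>w\<^sub>0\<close>, but a rotation other than the identity fixes only the centre.\<close>
  have "Infty \<notin> G"
  proof
    assume "Infty \<in> G"
    moreover have "poly_sphere f Infty = Infty" using assms(1) by simp
    ultimately have "\<Phi> Infty = \<Phi> (Fin w\<^sub>0)" using fix0 w0 by simp
    then show False using injG \<open>Infty \<in> G\<close> w0(1) by (auto dest: inj_onD)
  qed
  define D where "D = Fin -` G"
  have GD: "G = Fin ` D"
    using \<open>Infty \<notin> G\<close> unfolding D_def by (auto simp: image_iff) (metis riemann_sphere.exhaust)
  define \<phi> where "\<phi> = \<Phi> \<circ> Fin"
  have hol\<phi>: "\<phi> holomorphic_on D" using hol unfolding sphere_holomorphic_on_def \<phi>_def D_def by blast
  have bij\<phi>: "bij_betw \<phi> D (ball 0 1)"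
    unfolding \<phi>_def using bij inj_Fin by (intro bij_betw_trans[of Fin D G]) (auto simp: GD bij_betw_def intro: inj_on_subset)
  have connD: "connected D"
  proof -
    have "connected (finite_part ` G)"
      using comp \<open>Infty \<notin> G\<close>
      by (intro connected_continuous_image continuous_on_subset[OF continuous_on_finite_part]) (auto simp: in_components_connected)
    then show ?thesis by (simp add: GD image_image)
  qed
  have nbhd: "\<exists>e>0. ball z e \<subseteq> Fin -` fatou_set f" if "Fin z \<in> fatou_set f" for z
    using open_Fin_vimage[OF open_fatou_set, of f] that by (simp add: open_contains_ball)
  have ball_sub: "ball z e \<subseteq> D" if "ball z e \<subseteq> Fin -` fatou_set f" "ball z e \<inter> D \<noteq> {}" for z e
  proof -
    have "Fin ` ball z e \<subseteq> G"
    proof (rule components_maximal[OF comp])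
      show "connected (Fin ` ball z e)" by (intro connected_continuous_image continuous_on_Fin) simp
    qed (use that in \<open>auto simp: GD\<close>)
    then show ?thesis by (auto simp: D_def)
  qed
  have openD: "open D"
    unfolding open_contains_ball
  proof
    fix z assume z: "z \<in> D"
    then have "Fin z \<in> fatou_set f" using in_components_subset[OF comp] by (auto simp: D_def)
    then obtain e where "e > 0" "ball z e \<subseteq> Fin -` fatou_set f" using nbhd by blast
    then show "\<exists>e>0. ball z e \<subseteq> D" using ball_sub[of z e] z centre_in_ball by blast
  qed
  have frD: "Fin x \<notin> fatou_set f" if x: "x \<in> frontier D" for x
  proof
    assume "Fin x \<in> fatou_set f"
    then obtain e where e: "e > 0" "ball x e \<subseteq> Fin -` fatou_set f" using nbhd by blast
    have "x \<in> closure D" using x by (simp add: frontier_def)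
    then obtain y where "y \<in> D" "dist y x < e" using e(1) by (auto simp: closure_approachable)
    then have "ball x e \<inter> D \<noteq> {}" by (auto simp: dist_commute)
    then have "x \<in> D" using ball_sub e by (meson centre_in_ball subsetD)
    then show False using x openD by (simp add: frontier_def interior_open)
  qed
  obtain \<psi> where hol\<psi>: "\<psi> holomorphic_on ball 0 1" and \<psi>\<phi>: "\<And>z. z \<in> D \<Longrightarrow> \<psi> (\<phi> z) = z"
    using holomorphic_has_inverse[OF hol\<phi> openD] bij\<phi> unfolding bij_betw_def by metis
  have \<phi>D: "\<phi> z \<in> ball 0 1" if "z \<in> D" for z using bij\<phi> that by (auto simp: bij_betw_def)
  have \<psi>: "\<psi> w \<in> D" "\<phi> (\<psi> w) = w" if "w \<in> ball 0 1" for w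
  proof -
    have "w \<in> \<phi> ` D" using bij_betw_imp_surj_on[OF bij\<phi>] that by blast
    then obtain z where "z \<in> D" "w = \<phi> z" by blast
    then show "\<psi> w \<in> D" "\<phi> (\<psi> w) = w" using \<psi>\<phi> by auto
  qed
  have fD: "?F z \<in> D" "\<phi> (?F z) = c * \<phi> z" if "z \<in> D" for z
  proof -
    have "poly_sphere f (Fin z) \<in> G" using that fGG unfolding D_def by blast
    then show "?F z \<in> D" "\<phi> (?F z) = c * \<phi> z"
      using that conj[of "Fin z"] by (auto simp: D_def \<phi>_def)
  qed
  have iter: "(?F ^^ n) z \<in> D \<and> \<phi> ((?F ^^ n) z) = c ^ n * \<phi> z" if "z \<in> D" for n z
    using that by (induction n) (auto simp: fD)
  obtain R where R: "R > 0" "\<And>z. norm z > R \<Longrightarrow> norm (?F z) \<ge> 2 * norm z"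
    using escape_radius[OF assms(1)] by blast
  \<comment> \<open>Orbits in \<open>D\<close> are recurrent, while an orbit that starts outside the escape radius never comes back.\<close>
  have DR: "norm z \<le> R" if z: "z \<in> D" for z
  proof (rule ccontr)
    assume "\<not> norm z \<le> R"
    then have zR: "norm z > R" by simp
    have grow: "norm ((?F ^^ Suc n) z) \<ge> 2 * norm z" for n
    proof (induction n)
      case 0 then show ?case using R(2)[OF zR] by simp
    next
      case (Suc n)
      then have "norm ((?F ^^ Suc n) z) > R" using zR R(1) by linarith
      then have "norm ((?F ^^ Suc (Suc n)) z) \<ge> 2 * norm ((?F ^^ Suc n) z)" using R(2) by simp
      then show ?case using Suc zR R(1) by linarith
    qed
    have "isCont \<psi> (\<phi> z)"
      using hol\<psi> \<phi>D[OF z] by (meson continuous_on_eq_continuous_at holomorphic_on_imp_continuous_on open_ball)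
    moreover have "norm z > 0" using zR R(1) by linarith
    ultimately obtain \<delta> where \<delta>: "\<delta> > 0" "\<And>w. dist w (\<phi> z) < \<delta> \<Longrightarrow> dist (\<psi> w) (\<psi> (\<phi> z)) < norm z"
      unfolding continuous_at_eps_delta by (metis dist_norm)
    \<comment> \<open>The extra factor \<open>c\<close> makes the exponent positive; at time \<open>0\<close> the orbit is trivially at \<open>z\<close>.\<close>
    obtain n where n: "dist (c ^ n * c) 1 < \<delta>"
      using rotation_orbit_dense[OF c1 c_irr c1 _ \<delta>(1), of 1] by auto
    have "dist (c ^ Suc n * \<phi> z) (\<phi> z) = dist (c ^ n * c) 1 * norm (\<phi> z)"
      by (simp add: dist_norm norm_mult[symmetric] algebra_simps)
    also have "\<dots> \<le> dist (c ^ n * c) 1 * 1" using \<phi>D[OF z] by (intro mult_left_mono) auto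
    finally have "dist (\<psi> (c ^ Suc n * \<phi> z)) (\<psi> (\<phi> z)) < norm z" using n \<delta>(2) by simp
    moreover have "\<psi> (c ^ Suc n * \<phi> z) = (?F ^^ Suc n) z" using iter[OF z, of "Suc n"] \<psi>\<phi> by metis
    ultimately have "dist ((?F ^^ Suc n) z) z < norm z" using \<psi>\<phi>[OF z] by simp
    then show False using grow[of n] norm_triangle_ineq3[of "(?F ^^ Suc n) z" z] by (simp add: dist_norm del: funpow.simps)
  qed
  have bddD: "bounded D" using DR by (auto simp: bounded_iff)
  have clDR: "norm ((?F ^^ n) z) \<le> R" if "z \<in> closure D" for n z
  proof -
    have "continuous_on (closure D) (\<lambda>z. norm ((?F ^^ n) z))"
      by (intro continuous_on_norm holomorphic_on_imp_continuous_on holomorphic_on_poly_funpow)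
    then show ?thesis
      by (rule continuous_le_on_closure) (use that iter DR in auto)
  qed
  have out: "connected (outside (closure D))" "\<not> bounded (outside (closure D))"
      "outside (closure D) \<inter> closure D = {}"
    using bddD outside_no_overlap[of "closure D"]
    by (auto intro: connected_outside bounded_closure dest: unbounded_outside[OF bounded_closure])
  have "frontier D \<subseteq> closure (outside (closure D))"
    using outside_accumulates_at_julia_points[OF bddD frD clDR] by blast
  moreover have frG: "frontier G = Fin ` frontier D" unfolding GD using bddD openD by (rule frontier_Fin_image)
  moreover have "finite {z. ?F z = z}" using finite_periodic_points[OF assms(1), of 1] by simp
  moreover have "path_connected (frontier D)"
    using assms(3) unfolding frG by (rule path_connected_of_arcwise_connected_Fin)
  ultimately interpret irrational_rotation_domain D ?F \<phi> \<psi> c "outside (closure D)"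
    using openD connD bddD hol\<phi> hol\<psi> \<phi>D \<psi> \<psi>\<phi> c1 c_irr fD out
    by unfold_locales (auto intro: holomorphic_on_imp_continuous_on continuous_intros)
  obtain J where J: "simple_path J" "pathfinish J = pathstart J" "path_image J = frontier D"
    using frontier_is_simple_closed_curve by blast
  then have "frontier D homeomorphic sphere (0::complex) 1"
    using homeomorphic_simple_path_image_circle[of J 1 0] by simp
  moreover have "frontier G homeomorphic frontier D"
    unfolding frG using homeomorphism_Fin homeomorphic_def homeomorphic_sym by blast
  ultimately show ?thesis unfolding jordan_curve_def using homeomorphic_trans by blast
qed

end
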